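(* Suppose that every Erdős semi-group (ESG) $G\subset\mathbb{R}/\mathbb{Z}$ with full Hausdorff dimension (i.e. $\dim_{\mathrm{H}}G=1$) satisfies $G=\mathbb{R}/\mathbb{Z}$. Then Szemerédi's theorem holds: every $A\subset\mathbb{N}$ with positive upper Banach density contains arbitrarily long arithmetic progressions.
   Context: $\mathbb{N}=\{1,2,3,\dots\}$, and $\mathbb{R}/\mathbb{Z}$ is identified with $[0,1)$ in the natural way. Each $x\in[0,1)$ is identified with its binary expansion $x_1x_2\dots\in\{0,1\}^{\mathbb{N}}$, $x=\sum_{i\ge1}2^{-i}x_i$; if $x$ is a dyadic rational, the expansion with only finitely many digits $1$ is always used. $\dim_{\mathrm{H}}$ denotes Hausdorff dimension. $\times 2 \bmod 1$ invariance: a set $F\subset[0,1)$ is $\times2\bmod1$ invariant if $T(F)\subset F$, where $T(x)=2x\bmod 1$. Subsequence in terms of binary expansion: $y\in[0,1)$ is a subsequence of $x\in[0,1)$ in terms of binary expansion if there is an integer $N>0$ such that for all $i\in\mathbb{N}$, $y_{i+N}=1$ implies $x_i=1$, and $y_j=0$ for all $j\le N$. ESG: a set $G\subset\mathbb{R}/\mathbb{Z}$ is a (binary) Erdős semi-group (ESG) if: (1) $G=\bigcup_{i\in\mathbb{N}}F_i$ where each $F_i$ is a closed $\times2\bmod1$ invariant subset of $\mathbb{R}/\mathbb{Z}$; (2) there is a function $W:\mathbb{N}^2\to\mathbb{N}$ such that for all $i,j\in\mathbb{N}$, $F_i+F_j\subset F_{W(i,j)}$ (addition in $\mathbb{R}/\mathbb{Z}$);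 (3) for all $i\in\mathbb{N}$, if $x\in F_i$ then $y\in F_i$ for every subsequence $y$ of $x$ in terms of binary expansion. Upper Banach density: for $A\subset\mathbb{N}$ put $A(n)=\#(A\cap[1,n])$; the upper Banach density of $A$ is $d_B(A)=\limsup_{k,M\to\infty}\frac1k\bigl(A(M+k-1)-A(M)\bigr)$. *)

theory Defs
  imports "HOL-Analysis.Analysis"
begin

text \<open>
  The circle \<open>\<real>/\<int>\<close> is represented by its fundamental domain \<open>{0..<1}\<close>, with \<^term>\<open>frac\<close> as the
  quotient map \<open>\<real> \<rightarrow> \<real>/\<int>\<close>. The index set \<open>{1, 2, 3, \<dots>}\<close> is \<open>{1..}\<close> in \<^typ>\<open>nat\<close>.
\<close>

definition circle :: "real set" where
  "circle = {0..<1}"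

text \<open>Closedness in the quotient topology of \<open>\<real>/\<int>\<close>, not in the subspace \<open>{0..<1}\<close> of \<open>\<real>\<close>: a closed
  set whose points accumulate at \<open>1\<close> must contain \<open>0\<close>.\<close>

definition circle_closed :: "real set \<Rightarrow> bool" where
  "circle_closed F \<longleftrightarrow> F \<subseteq> circle \<and> closed (frac -` F)"

definition circle_sum :: "real set \<Rightarrow> real set \<Rightarrow> real set" where
  "circle_sum A B = {frac (x + y) | x y. x \<in> A \<and> y \<in> B}"

definition times2_invariant :: "real set \<Rightarrow> bool" where
  "times2_invariant F \<longleftrightarrow> F \<subseteq> circle \<and> (\<lambda>x. frac (2 * x)) ` F \<subseteq> F"

text \<open>The \<open>i\<close>-th binary digit, \<open>i \<ge> 1\<close>, of \<open>x \<in> {0..<1}\<close>. The lemmas below show that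
  this is a binary expansion of \<open>x\<close>, and the finite one when \<open>x\<close> is a dyadic rational.\<close>

definition binary_digit :: "real \<Rightarrow> nat \<Rightarrow> int" where
  "binary_digit x i = \<lfloor>2 ^ i * x\<rfloor> mod 2"

lemma binary_digit_01: "binary_digit x i \<in> {0, 1}"
  unfolding binary_digit_def by auto

lemma binary_digit_partial_sum:
  assumes "x \<in> circle"
  shows "(\<Sum>i<n. real_of_int (binary_digit x (Suc i)) / 2 ^ Suc i) = real_of_int \<lfloor>2 ^ n * x\<rfloor> / 2 ^ n"
proof (induction n)
  case 0
  have "\<lfloor>x\<rfloor> = 0"
    using assms by (simp add: circle_def floor_eq_iff)
  then show ?case by simp
next
  case (Suc n)
  have "\<lfloor>2 ^ n * x\<rfloor> = \<lfloor>2 ^ Suc n * x\<rfloor> div 2"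
    using floor_divide_real_eq_div[of 2 "2 ^ Suc n * x"] by simp
  then have "\<lfloor>2 ^ Suc n * x\<rfloor> = 2 * \<lfloor>2 ^ n * x\<rfloor> + binary_digit x (Suc n)"
    unfolding binary_digit_def by presburger
  then have "real_of_int \<lfloor>2 ^ Suc n * x\<rfloor> =
      2 * real_of_int \<lfloor>2 ^ n * x\<rfloor> + real_of_int (binary_digit x (Suc n))"
    by simp
  then show ?case
    using Suc by (simp add: field_simps)
qed

lemma binary_digit_sums:
  assumes "x \<in> circle"
  shows "(\<lambda>i. real_of_int (binary_digit x (Suc i)) / 2 ^ Suc i) sums x"
proof -
  have lim: "(\<lambda>n. x - 1 / 2 ^ n) \<longlonglongrightarrow> x"
    using tendsto_diff[OF tendsto_const[of x] LIMSEQ_inverse_realpow_zero[of 2]]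
    by (simp add: divide_inverse)
  have "(\<lambda>n. real_of_int \<lfloor>2 ^ n * x\<rfloor> / 2 ^ n) \<longlonglongrightarrow> x"
  proof (rule real_tendsto_sandwich[OF _ _ lim tendsto_const])
    show "\<forall>\<^sub>F n in sequentially. x - 1 / 2 ^ n \<le> real_of_int \<lfloor>2 ^ n * x\<rfloor> / 2 ^ n"
    proof (rule always_eventually, rule allI)
      fix n
      have "2 ^ n * x - 1 \<le> real_of_int \<lfloor>2 ^ n * x\<rfloor>" by linarith
      then have "(2 ^ n * x - 1) / 2 ^ n \<le> real_of_int \<lfloor>2 ^ n * x\<rfloor> / 2 ^ n"
        by (rule divide_right_mono) simp
      then show "x - 1 / 2 ^ n \<le> real_of_int \<lfloor>2 ^ n * x\<rfloor> / 2 ^ n"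
        by (simp add: diff_divide_distrib)
    qed
    show "\<forall>\<^sub>F n in sequentially. real_of_int \<lfloor>2 ^ n * x\<rfloor> / 2 ^ n \<le> x"
    proof (rule always_eventually, rule allI)
      fix n
      have "real_of_int \<lfloor>2 ^ n * x\<rfloor> \<le> 2 ^ n * x" by linarith
      then show "real_of_int \<lfloor>2 ^ n * x\<rfloor> / 2 ^ n \<le> x"
        by (simp add: field_simps)
    qed
  qed
  then show ?thesis
    unfolding sums_def binary_digit_partial_sum[OF assms] .
qed

lemma binary_digit_dyadic_finite:
  assumes "x = real_of_int m / 2 ^ n"
  shows "finite {i. binary_digit x i = 1}"
proof (rule finite_subset)
  show "{i. binary_digit x i = 1} \<subseteq> {..n}"
  proof (rule subsetI, rule ccontr)
    fix i assume i: "i \<in> {i. binary_digit x i = 1}" "i \<notin> {..n}"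
    then obtain k where k: "i = n + Suc k"
      using less_imp_Suc_add[of n i] by auto
    have "2 ^ i * x = real_of_int (2 * (2 ^ k * m))"
      unfolding assms k by (simp add: power_add)
    then have "\<lfloor>2 ^ i * x\<rfloor> = 2 * (2 ^ k * m)"
      by (metis floor_of_int)
    then show False
      using i by (simp add: binary_digit_def)
  qed
qed simp

definition binary_subsequence :: "real \<Rightarrow> real \<Rightarrow> bool" where
  "binary_subsequence y x \<longleftrightarrow> y \<in> circle \<and> x \<in> circle \<and>
     (\<exists>N>0. (\<forall>i\<ge>1. binary_digit y (i + N) = 1 \<longrightarrow> binary_digit x i = 1) \<and>
            (\<forall>j\<in>{1..N}. binary_digit y j = 0))"

definition erdos_semigroup :: "real set \<Rightarrow> bool" where
  "erdos_semigroup G \<longleftrightarrow> (\<exists>F :: nat \<Rightarrow> real set.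
     G = (\<Union>i\<in>{1..}. F i) \<and>
     (\<forall>i\<ge>1. circle_closed (F i) \<and> times2_invariant (F i)) \<and>
     (\<exists>W :: nat \<Rightarrow> nat \<Rightarrow> nat. \<forall>i\<ge>1. \<forall>j\<ge>1. W i j \<ge> 1 \<and> circle_sum (F i) (F j) \<subseteq> F (W i j)) \<and>
     (\<forall>i\<ge>1. \<forall>x\<in>F i. \<forall>y. binary_subsequence y x \<longrightarrow> y \<in> F i))"

text \<open>Hausdorff measure and dimension. The weight of a set is \<open>(diam U)\<^sup>s\<close>, with the usual conventions
  that the empty set has weight \<open>0\<close> and that \<open>0\<^sup>0 = 1\<close> for nonempty sets (whereas \<open>0 powr 0 = 0\<close>).
  Covering sets are required to be bounded because \<^const>\<open>diameter\<close> is meaningless otherwise.\<close>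

definition diam_weight :: "real \<Rightarrow> 'a::metric_space set \<Rightarrow> ennreal" where
  "diam_weight s U = (if U = {} then 0 else if s = 0 then 1 else ennreal (diameter U powr s))"

definition hausdorff_premeasure :: "real \<Rightarrow> real \<Rightarrow> 'a::metric_space set \<Rightarrow> ennreal" where
  "hausdorff_premeasure s \<delta> E =
     Inf {\<Sum>n. diam_weight s (U n) | U :: nat \<Rightarrow> 'a set.
            E \<subseteq> (\<Union>n. U n) \<and> (\<forall>n. bounded (U n) \<and> diameter (U n) \<le> \<delta>)}"

definition hausdorff_measure :: "real \<Rightarrow> 'a::metric_space set \<Rightarrow> ennreal" where
  "hausdorff_measure s E = (SUP \<delta>\<in>{0<..}. hausdorff_premeasure s \<delta> E)"

definition hausdorff_dim :: "'a::metric_space set \<Rightarrow> ennreal" where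
  "hausdorff_dim E = Inf {ennreal s | s. s \<ge> 0 \<and> hausdorff_measure s E = 0}"

definition counting :: "nat set \<Rightarrow> nat \<Rightarrow> nat" where
  "counting A n = card (A \<inter> {1..n})"

text \<open>The limit superior is taken as \<open>k\<close> and \<open>M\<close> tend to infinity jointly and independently.\<close>

definition upper_Banach_density :: "nat set \<Rightarrow> ereal" where
  "upper_Banach_density A =
     Limsup (at_top \<times>\<^sub>F at_top)
       (\<lambda>(k, M). ereal ((real (counting A (M + k - 1)) - real (counting A M)) / real k))"

definition has_arbitrarily_long_APs :: "nat set \<Rightarrow> bool" where
  "has_arbitrarily_long_APs A \<longleftrightarrow> (\<forall>l. \<exists>a d. d > 0 \<and> (\<forall>j<l. a + j * d \<in> A))"

end

theory Submission
  imports Defs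
begin

text \<open>
  Let \<open>F\<^sub>l\<close> be the set of points whose set of digits \<open>1\<close> contains no progression of length \<open>l\<close>. Every
  digit \<open>1\<close> of \<open>x + y\<close> is at or next to a digit \<open>1\<close> of \<open>x\<close> or \<open>y\<close>, so by van der Waerden's theorem
  \<open>G = \<Union>l. F\<^sub>l\<close> is an Erdos semigroup; it omits \<open>2/3 = 0.101010\<dots>\<close>. Now let \<open>A\<close> be a counterexample to
  Szemeredi's theorem. By van der Waerden again, the finite unions of translates of \<open>A\<close> also have no long
  progressions, and their Banach densities come arbitrarily close to \<open>1\<close> (Hindman). Hence, for every
  \<open>s < 1\<close>, some \<open>F\<^sub>l\<close> has more than \<open>2\<^sup>s\<^sup>n\<close> words of length \<open>n\<close>, up to any constant factor. For a closed
  \<open>\<times>2\<close>-invariant set this forces positive \<open>s\<close>-dimensional Hausdorff measure: a finite cover of small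
  total weight would, applied repeatedly along the orbits, bound the number of words by a multiple
  of \<open>2\<^sup>s\<^sup>n\<close>. So \<open>G\<close> has dimension \<open>1\<close>, against the hypothesis.
\<close>

section \<open>Van der Waerden's theorem\<close>

definition has_AP :: "nat \<Rightarrow> nat set \<Rightarrow> bool" where
  "has_AP l X \<longleftrightarrow> (\<exists>a d. d > 0 \<and> (\<forall>j<l. a + j * d \<in> X))"

lemma has_AP_mono: "has_AP l X \<Longrightarrow> X \<subseteq> Y \<Longrightarrow> has_AP l Y"
  unfolding has_AP_def by blast

lemma has_AP_antimono: "has_AP m X \<Longrightarrow> l \<le> m \<Longrightarrow> has_AP l X"
  unfolding has_AP_def by (meson less_le_trans)

lemma has_AP_vimage_add:
  assumes "has_AP l {i. i + t \<in> X}"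
  shows "has_AP l X"
proof -
  obtain a d where "d > 0" "\<forall>j<l. a + j * d \<in> {i. i + t \<in> X}"
    using assms unfolding has_AP_def by blast
  then have "d > 0 \<and> (\<forall>j<l. (a + t) + j * d \<in> X)"
    by (simp add: ac_simps)
  then show ?thesis
    unfolding has_AP_def by blast
qed

lemma has_AP_image_add:
  assumes "has_AP l ((\<lambda>i. i + t) ` X)"
  shows "has_AP l X"
proof -
  obtain a d where d: "d > 0" and ad: "\<forall>j<l. a + j * d \<in> (\<lambda>i. i + t) ` X"
    using assms unfolding has_AP_def by blast
  have "(a - t) + j * d \<in> X" if "j < l" for j
  proof -
    have "a + j * d \<in> (\<lambda>i. i + t) ` X"
      using ad that by blast
    then obtain i where i: "i \<in> X" "a + j * d = i + t" by blast
    \<comment> \<open>The first term already lies in the translate, so \<open>t \<le> a\<close> and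
      the truncated difference \<open>a - t\<close> is exact.\<close>
    have "a + 0 * d \<in> (\<lambda>i. i + t) ` X"
      using ad that by (metis gr_zeroI not_less_zero)
    then have "t \<le> a" by auto
    with i have "(a - t) + j * d = i" by simp
    with i show ?thesis by simp
  qed
  with d show ?thesis
    unfolding has_AP_def by blast
qed

section \<open>Van der Waerden's theorem by colour focusing\<close>

text \<open>The point \<open>a\<close> itself need not have the common colour: it is the focus of the progression.\<close>

definition vdW :: "nat \<Rightarrow> bool" where
  "vdW k \<longleftrightarrow> (\<forall>C :: nat set. finite C \<longrightarrow> (\<exists>N. \<forall>col. range col \<subseteq> C \<longrightarrow>
     (\<exists>a d c. d > 0 \<and> a + k * d < N \<and> (\<forall>j\<in>{1..k}. col (a + j * d) = c))))"

lemma vdWD: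
  fixes C :: "nat set"
  assumes "vdW k" "finite C"
  shows "\<exists>N. \<forall>col. range col \<subseteq> C \<longrightarrow>
     (\<exists>a d c. d > 0 \<and> a + k * d < N \<and> (\<forall>j\<in>{1..k}. col (a + j * d) = c))"
  using assms(1)[unfolded vdW_def, rule_format, OF assms(2)] .

text \<open>The index starts at \<open>j = 0\<close>, so the focus shares the colour: this is the
  additional term that leads from \<open>vdW k\<close> to \<open>vdW (Suc k)\<close>.\<close>

definition mono_AP :: "nat \<Rightarrow> nat \<Rightarrow> (nat \<Rightarrow> nat) \<Rightarrow> bool" where
  "mono_AP k n col \<longleftrightarrow> (\<exists>f d c. d > 0 \<and> f + k * d < n \<and> (\<forall>j\<le>k. col (f + j * d) = c))"

text \<open>\<open>T\<close> collects colours of progressions that all point to the same focus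
  \<open>f\<close>. If \<open>f\<close> itself has a colour in \<open>T\<close>, it completes one of
  them.\<close>

definition focused :: "nat \<Rightarrow> nat \<Rightarrow> (nat \<Rightarrow> nat) \<Rightarrow> nat \<Rightarrow> nat set \<Rightarrow> bool" where
  "focused k n col f T \<longleftrightarrow> f < n \<and> finite T \<and>
     (\<forall>c\<in>T. \<exists>d>0. f + k * d < n \<and> (\<forall>j\<in>{1..k}. col (f + j * d) = c))"

lemma mono_AP_shift:
  assumes "mono_AP k n (\<lambda>i. col (m + i))" "m + n \<le> n'"
  shows "mono_AP k n' col"
proof -
  obtain f d c where "d > 0" "f + k * d < n" "\<forall>j\<le>k. col (m + (f + j * d)) = c"
    using assms(1) unfolding mono_AP_def by blast
  then have "d > 0 \<and> (m + f) + k * d < n' \<and> (\<forall>j\<le>k. col ((m + f) + j * d) = c)"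
    using assms(2) by (auto simp: add.assoc)
  then show ?thesis
    unfolding mono_AP_def by blast
qed

lemma mono_AP_if_focus_colour:
  assumes "focused k n col f T" "col f \<in> T"
  shows "mono_AP k n col"
proof -
  obtain d where d: "d > 0" "f + k * d < n" "\<forall>j\<in>{1..k}. col (f + j * d) = col f"
    using assms unfolding focused_def by blast
  have "col (f + j * d) = col f" if "j \<le> k" for j
    using d(3) that by (cases "j = 0") auto
  with d show ?thesis
    unfolding mono_AP_def by blast
qed

text \<open>Colour each position by the block of \<open>n\<close> colours starting there and apply
  \<open>vdW k\<close>. This gives \<open>k\<close> equal windows in progression. The progressions
  found in the first window can be stretched across the windows, and the copies of their focus form
  one more progression; all of them focus at the corresponding point of the window at
  \<open>a\<close>.\<close>

lemma focusing_step:
  assumes vdW: "vdW k" and C: "finite C"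
    and n: "\<And>col. range col \<subseteq> C \<Longrightarrow> mono_AP k n col \<or> (\<exists>f T. card T = s \<and> focused k n col f T)"
  shows "\<exists>n'. \<forall>col. range col \<subseteq> C \<longrightarrow>
    mono_AP k n' col \<or> (\<exists>f T. card T = Suc s \<and> focused k n' col f T)"
proof -
  \<comment> \<open>Colours in \<open>vdW\<close> are natural numbers, so \<open>to_nat\<close>
    encodes each block; finitely many blocks occur because \<open>C\<close> is finite.\<close>
  define window where "window col i = to_nat (map (\<lambda>t. col (i + t)) [0..<n])" for col :: "nat \<Rightarrow> nat" and i
  have fin: "finite (to_nat ` {xs. set xs \<subseteq> C \<and> length xs = n})"
    by (rule finite_imageI[OF finite_lists_length_eq[OF C]])
  obtain N where "\<forall>col. range col \<subseteq> to_nat ` {xs. set xs \<subseteq> C \<and> length xs = n} \<longrightarrow>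
     (\<exists>a d c. d > 0 \<and> a + k * d < N \<and> (\<forall>j\<in>{1..k}. col (a + j * d) = c))"
    using vdWD[OF vdW fin] ..
  note N = this[rule_format]
  have "mono_AP k (2 * N + n) col \<or> (\<exists>f T. card T = Suc s \<and> focused k (2 * N + n) col f T)"
    if col: "range col \<subseteq> C" for col
  proof -
    have "range (window col) \<subseteq> to_nat ` {xs. set xs \<subseteq> C \<and> length xs = n}"
      using col by (auto simp: window_def image_subset_iff intro!: imageI)
    then obtain a D c where D: "D > 0" "a + k * D < N"
      and w: "\<And>j. j \<in> {1..k} \<Longrightarrow> window col (a + j * D) = c"
      using N[of "window col"] by blast
    show ?thesis
    proof (cases "k = 0")
      case True
      then have "mono_AP k (2 * N + n) col"
        using D unfolding mono_AP_def by (auto intro: exI[of _ 0] exI[of _ "1 :: nat"])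
      then show ?thesis ..
    next
      case False
      then have k: "k \<ge> 1" by simp
      have "D \<le> k * D" using k by simp
      with D have aD: "a + D < N" by linarith
      have period: "col (a + j * D + t) = col (a + D + t)" if "j \<in> {1..k}" "t < n" for j t
      proof -
        have "window col (a + j * D) = window col (a + 1 * D)"
          using w[of j] w[of 1] that k by simp
        then have "map (\<lambda>t. col (a + j * D + t)) [0..<n] = map (\<lambda>t. col (a + D + t)) [0..<n]"
          by (simp add: window_def)
        then show ?thesis
          using that by (simp add: list_eq_iff_nth_eq)
      qed
      let ?col = "\<lambda>i. col (a + D + i)"
      have "range ?col \<subseteq> C" using col by blast
      consider "mono_AP k n ?col" | f T where "card T = s" "focused k n ?col f T"
        using n[OF \<open>range ?col \<subseteq> C\<close>] by blast
      then show ?thesis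
      proof cases
        case 1
        then show ?thesis
          using mono_AP_shift[of k n col "a + D" "2 * N + n"] aD by simp
      next
        case (2 f T)
        show ?thesis
        proof (cases "?col f \<in> T")
          case True
          then have "mono_AP k n ?col"
            using mono_AP_if_focus_colour 2 by blast
          then show ?thesis
            using mono_AP_shift[of k n col "a + D" "2 * N + n"] aD by simp
        next
          case False
          have f: "f < n" and T: "finite T"
            using 2 unfolding focused_def by auto
          have "\<exists>d>0. a + f + k * d < 2 * N + n \<and> (\<forall>j\<in>{1..k}. col (a + f + j * d) = c)"
            if c: "c \<in> insert (?col f) T" for c
          proof (cases "c = ?col f")
            case True
            then have "\<forall>j\<in>{1..k}. col (a + f + j * D) = c"
              using period[OF _ f] by (simp add: ac_simps)
            with D f show ?thesis
              by (intro exI[of _ D]) auto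
          next
            case False
            with c obtain d where d: "d > 0" "f + k * d < n" "\<forall>j\<in>{1..k}. ?col (f + j * d) = c"
              using 2 unfolding focused_def by blast
            \<comment> \<open>The \<open>j\<close>-th term is taken from the \<open>j\<close>-th
              window: \<open>(a + f) + j * (d + D) = (a + j * D) + (f + j * d)\<close>.\<close>
            have "col (a + f + j * (d + D)) = c" if "j \<in> {1..k}" for j
            proof -
              have "f + j * d < n"
                using d(2) that by (meson add_le_cancel_left atLeastAtMost_iff le_less_trans mult_le_mono1)
              then have "col (a + j * D + (f + j * d)) = c"
                using period that d(3) by simp
              then show ?thesis by (simp add: algebra_simps)
            qed
            with D d show ?thesis
              by (intro exI[of _ "d + D"]) (auto simp: algebra_simps)
          qed
          then have "focused k (2 * N + n) col (a + f) (insert (?col f) T)"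
            using f T D unfolding focused_def by auto
          moreover have "card (insert (?col f) T) = Suc s"
            using False T 2 by simp
          ultimately show ?thesis by blast
        qed
      qed
    qed
  qed
  then show ?thesis by blast
qed

text \<open>More than \<open>card C\<close> colours cannot be focused, so some focus completes a
  progression of \<open>k + 1\<close> equal terms. Stepping back by one difference supplies the new
  focus.\<close>

lemma vdW_Suc:
  assumes "vdW k" "k \<ge> 1"
  shows "vdW (Suc k)"
  unfolding vdW_def
proof (intro allI impI)
  fix C :: "nat set"
  assume C: "finite C"
  have foc: "\<exists>n. \<forall>col. range col \<subseteq> C \<longrightarrow> mono_AP k n col \<or> (\<exists>f T. card T = s \<and> focused k n col f T)" for s
  proof (induction s)
    case 0
    have "focused k 1 col 0 {}" for col
      unfolding focused_def by simp
    then show ?case by (metis card.empty)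
  next
    case (Suc s)
    then obtain n where "\<forall>col. range col \<subseteq> C \<longrightarrow>
        mono_AP k n col \<or> (\<exists>f T. card T = s \<and> focused k n col f T)" ..
    from focusing_step[OF assms(1) C this[rule_format]] show ?case .
  qed
  obtain n where "\<forall>col. range col \<subseteq> C \<longrightarrow>
      mono_AP k n col \<or> (\<exists>f T. card T = Suc (card C) \<and> focused k n col f T)"
    using foc[of "Suc (card C)"] ..
  note n = this[rule_format]
  have mono: "mono_AP k n col" if col: "range col \<subseteq> C" for col
  proof -
    have False if "card T = Suc (card C)" "focused k n col f T" for f T
    proof -
      have "T \<subseteq> C"
      proof (rule subsetI)
        fix c assume "c \<in> T"
        then obtain d where "\<forall>j\<in>{1..k}. col (f + j * d) = c"
          using \<open>focused k n col f T\<close> unfolding focused_def by blast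
        then have "col (f + 1 * d) = c" using assms(2) by (metis atLeastAtMost_iff order_refl)
        then show "c \<in> C" using col rangeI[of col "f + 1 * d"] by auto
      qed
      then show False
        using card_mono[OF C, of T] that(1) by simp
    qed
    then show ?thesis using n[OF col] by blast
  qed
  show "\<exists>N. \<forall>col. range col \<subseteq> C \<longrightarrow>
     (\<exists>a d c. d > 0 \<and> a + Suc k * d < N \<and> (\<forall>j\<in>{1..Suc k}. col (a + j * d) = c))"
  \<comment> \<open>The progression is sought from position \<open>n\<close> on: since
    \<open>d \<le> k * d < n\<close>, the new focus \<open>n + f - d\<close> does not
    underflow.\<close>
  proof (rule exI[of _ "2 * n"], rule allI, rule impI)
    fix col :: "nat \<Rightarrow> nat"
    assume "range col \<subseteq> C"
    then have "range (\<lambda>i. col (n + i)) \<subseteq> C" by auto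
    from mono[OF this] obtain f d c where d: "d > 0" "f + k * d < n"
      and c: "\<And>j. j \<le> k \<Longrightarrow> col (n + (f + j * d)) = c"
      unfolding mono_AP_def by blast
    have "d \<le> k * d" using assms(2) by simp
    with d have "d \<le> n + f" by linarith
    have "col ((n + f - d) + j * d) = c" if "j \<in> {1..Suc k}" for j
    proof -
      obtain i where i: "j = Suc i" "i \<le> k"
        using \<open>j \<in> {1..Suc k}\<close> by (cases j) auto
      with \<open>d \<le> n + f\<close> have "(n + f - d) + j * d = n + (f + i * d)" by simp
      with c i show ?thesis by simp
    qed
    moreover have "(n + f - d) + Suc k * d < 2 * n"
      using d \<open>d \<le> n + f\<close> by simp
    ultimately show "\<exists>a d c. d > 0 \<and> a + Suc k * d < 2 * n \<and> (\<forall>j\<in>{1..Suc k}. col (a + j * d) = c)"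
      using d by blast
  qed
qed

lemma van_der_Waerden:
  assumes "k \<ge> 1"
  shows "vdW k"
  using assms
proof (induction k rule: dec_induct)
  case base
  show ?case
    unfolding vdW_def
  proof (rule allI, rule impI, rule exI[of _ 2], rule allI, rule impI)
    fix C :: "nat set" and col :: "nat \<Rightarrow> nat"
    show "\<exists>a d c. d > 0 \<and> a + 1 * d < 2 \<and> (\<forall>j\<in>{1..1}. col (a + j * d) = c)"
      by (rule exI[of _ 0], rule exI[of _ 1]) auto
  qed
next
  case (step k)
  then show ?case by (simp add: vdW_Suc)
qed

text \<open>Colour the indices of a long progression in \<open>X \<union> Y\<close> by membership in
  \<open>X\<close>; a monochromatic progression of indices is a progression in \<open>X\<close> or
  in \<open>Y\<close>. The bound \<open>N\<close> depends only on \<open>p\<close> and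
  \<open>q\<close>, as the function \<open>W\<close> of an Erdos semigroup requires.\<close>

lemma AP_free_Un:
  "\<exists>N. \<forall>X Y. \<not> has_AP p X \<longrightarrow> \<not> has_AP q Y \<longrightarrow> \<not> has_AP N (X \<union> Y)"
proof -
  define k where "k = Suc (max p q)"
  have "vdW k" by (rule van_der_Waerden) (simp add: k_def)
  obtain N where "\<forall>col. range col \<subseteq> {0, 1 :: nat} \<longrightarrow>
     (\<exists>a d c. d > 0 \<and> a + k * d < N \<and> (\<forall>j\<in>{1..k}. col (a + j * d) = c))"
    using vdWD[of k "{0, 1}", OF \<open>vdW k\<close> finite.insertI[OF finite.insertI[OF finite.emptyI]]] ..
  note N = this[rule_format]
  have "has_AP p X \<or> has_AP q Y" if XY: "has_AP N (X \<union> Y)" for X Y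
  proof -
    obtain b e where e: "e > 0" and be: "\<And>j. j < N \<Longrightarrow> b + j * e \<in> X \<union> Y"
      using XY unfolding has_AP_def by blast
    define col where "col i = (if b + i * e \<in> X then 1 else 0 :: nat)" for i
    have "range col \<subseteq> {0, 1}" by (auto simp: col_def)
    then obtain a d c where d: "d > 0" "a + k * d < N"
      and c: "\<And>j. j \<in> {1..k} \<Longrightarrow> col (a + j * d) = c"
      using N[of col] by blast
    have same: "col (a + Suc j * d) = c" if "j < k" for j
      using c[of "Suc j"] that by simp
    \<comment> \<open>The focus of the index progression is uncoloured, so the progression starts
      one difference later, at index \<open>a + d\<close>.\<close>
    have pos: "b + (a + Suc j * d) * e = (b + a * e + d * e) + j * (d * e)" for j
      by (simp add: algebra_simps)
    have bound: "a + Suc j * d < N" if "j < k" for j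
    proof -
      have "Suc j * d \<le> k * d" using that by (intro mult_le_mono1) simp
      with d show ?thesis by linarith
    qed
    have de: "d * e > 0" using d e by simp
    show ?thesis
    proof (cases "c = 1")
      case True
      then have "\<forall>j<k. (b + a * e + d * e) + j * (d * e) \<in> X"
        using same unfolding col_def pos by (metis zero_neq_one)
      with de have "has_AP k X" unfolding has_AP_def by blast
      then show ?thesis
        using has_AP_antimono[of k X p] by (simp add: k_def)
    next
      case False
      then have "\<forall>j<k. (b + a * e + d * e) + j * (d * e) \<in> Y"
        using same be[OF bound] unfolding col_def pos by (metis UnE)
      with de have "has_AP k Y" unfolding has_AP_def by blast
      then show ?thesis
        using has_AP_antimono[of k Y q] by (simp add: k_def)
    qed
  qed
  then show ?thesis by blast
qed

section \<open>Density of unions of translates\<close>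

text \<open>Upper Banach density at least \<open>c\<close>, phrased by actual windows instead of a
  limit superior: the length must grow, the position is free.\<close>

definition window_dense :: "real \<Rightarrow> nat set \<Rightarrow> bool" where
  "window_dense c A \<longleftrightarrow> (\<forall>K. \<exists>k\<ge>K. \<exists>M. c * real k \<le> real (card (A \<inter> {M<..M + k})))"

definition thicken :: "nat \<Rightarrow> nat set \<Rightarrow> nat set" where
  "thicken L A = (\<Union>t\<le>L. (\<lambda>i. i + t) ` A)"

lemma thicken_Suc: "thicken (Suc L) A = thicken L A \<union> (\<lambda>i. i + Suc L) ` A"
  unfolding thicken_def by (auto simp: atMost_Suc)

lemma thicken_add:
  assumes "x \<in> thicken L A" "x \<le> y" "y \<le> x + R"
  shows "y \<in> thicken (L + R) A"
proof -
  obtain a t where "a \<in> A" "t \<le> L" "x = a + t"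
    using assms(1) unfolding thicken_def by blast
  then have "y = a + (t + (y - x))" "t + (y - x) \<le> L + R"
    using assms by auto
  with \<open>a \<in> A\<close> show ?thesis
    unfolding thicken_def by blast
qed

text \<open>The translates are added one at a time, each absorbed by
  \<open>AP_free_Un\<close>.\<close>

lemma thicken_AP_free:
  assumes "\<not> has_AP l A"
  shows "\<exists>N. \<not> has_AP N (thicken L A)"
proof (induction L)
  case 0
  then show ?case using assms by (auto simp: thicken_def)
next
  case (Suc L)
  then obtain N where N: "\<not> has_AP N (thicken L A)" by blast
  obtain N' where "\<forall>X Y. \<not> has_AP N X \<longrightarrow> \<not> has_AP l Y \<longrightarrow> \<not> has_AP N' (X \<union> Y)"
    using AP_free_Un ..
  then show ?case
    using N assms has_AP_image_add unfolding thicken_Suc by blast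
qed

lemma window_dense_le_1:
  assumes "window_dense c A"
  shows "c \<le> 1"
proof -
  obtain k M where k: "k \<ge> 1" "c * real k \<le> real (card (A \<inter> {M<..M + k}))"
    using assms unfolding window_dense_def by (meson order_refl)
  have "card (A \<inter> {M<..M + k}) \<le> card {M<..M + k}"
    by (intro card_mono) auto
  then have "card (A \<inter> {M<..M + k}) \<le> k" by simp
  then have "c * real k \<le> 1 * real k"
    using k by linarith
  with k(1) show ?thesis by (auto simp only: mult_le_cancel_right)
qed

section \<open>Counting points in consecutive blocks of equal length\<close>

lemma blocks_cover: "{M<..M + m * q} = (\<Union>i<m. {M + i * q<..M + i * q + (q::nat)})"
proof (induction m)
  case (Suc m)
  have "{M<..M + Suc m * q} = {M<..M + m * q} \<union> {M + m * q<..M + m * q + q}"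
    by (auto simp: algebra_simps)
  with Suc show ?case by (simp add: lessThan_Suc Un_commute)
qed simp

lemma disjoint_blocks:
  fixes M q :: nat
  assumes "i \<noteq> j"
  shows "{M + i * q<..M + i * q + q} \<inter> {M + j * q<..M + j * q + q} = {}"
proof -
  have *: "{M + i * q<..M + i * q + q} \<inter> {M + j * q<..M + j * q + q} = {}" if "i < j" for i j :: nat
  proof -
    have "Suc i * q \<le> j * q" using that by (intro mult_le_mono1) simp
    then show ?thesis by auto
  qed
  from assms show ?thesis
    using *[of i j] *[of j i] by (metis Int_commute linorder_neq_iff)
qed

text \<open>If windows of length \<open>q\<close> never have density above \<open>u\<close> and a long window has density \<open>c\<close>, then
  a proportion of about \<open>c / u\<close> of its subwindows meet \<open>A\<close>, and thickening fills the next ones.\<close>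

lemma card_thicken_window:
  assumes q: "q > 0" and u: "\<And>M. real (card (A \<inter> {M<..M + q})) \<le> u * real q"
    and c: "c * real k \<le> real (card (A \<inter> {M<..M + k}))"
  shows "c * real k - real q \<le> u * real (card ((\<Union>x\<in>A. {x..x + 2 * q}) \<inter> {M + q<..M + q + k}))"
proof -
  define m where "m = k div q"
  define b where "b i = {M + i * q<..M + i * q + q}" for i
  define I where "I = {i. i < m \<and> A \<inter> b i \<noteq> {}}"
  have I: "finite I" unfolding I_def by simp
  have kmq: "k < m * q + q" "m * q \<le> k"
    using mod_less_divisor[OF q, of k] div_mult_mod_eq[of k q] unfolding m_def by linarith+
  have u0: "0 \<le> u"
    using u[of 0] q by (smt (verit, best) mult_neg_pos of_nat_0_le_iff of_nat_0_less_iff)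
  \<comment> \<open>Only blocks that meet \<open>A\<close> count; the incomplete last block costs at
    most \<open>q\<close> points, which is the loss in the conclusion.\<close>
  have "A \<inter> {M<..M + k} \<subseteq> A \<inter> {M<..M + m * q} \<union> {M + m * q<..M + m * q + q}"
    using kmq by auto
  also have "\<dots> \<subseteq> (\<Union>i\<in>I. A \<inter> b i) \<union> {M + m * q<..M + m * q + q}"
    unfolding blocks_cover I_def b_def by blast
  finally have "card (A \<inter> {M<..M + k}) \<le> card ((\<Union>i\<in>I. A \<inter> b i) \<union> {M + m * q<..M + m * q + q})"
    using I by (intro card_mono) (auto simp: b_def)
  also have "\<dots> \<le> card (\<Union>i\<in>I. A \<inter> b i) + q"
    by (metis card_Un_le card_greaterThanAtMost diff_add_inverse)
  also have "\<dots> \<le> (\<Sum>i\<in>I. card (A \<inter> b i)) + q"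
    by (intro add_right_mono card_UN_le[OF I])
  finally have "c * real k \<le> (\<Sum>i\<in>I. real (card (A \<inter> b i))) + real q"
    using c by (simp flip: of_nat_sum of_nat_add)
  also have "\<dots> \<le> (\<Sum>i\<in>I. u * real q) + real q"
    unfolding b_def using u by (intro add_right_mono sum_mono) auto
  finally have le: "c * real k - real q \<le> u * real (card I * q)"
    by (simp add: mult_ac)
  \<comment> \<open>Every point of the next block lies to the right of each point of block
    \<open>i\<close>, at distance at most \<open>2 * q\<close>. In block \<open>i\<close> itself the
    points before the first element of \<open>A\<close> could be missed.\<close>
  have "(\<Union>i\<in>I. b (Suc i)) \<subseteq> (\<Union>x\<in>A. {x..x + 2 * q}) \<inter> {M + q<..M + q + k}"
  proof
    fix y assume "y \<in> (\<Union>i\<in>I. b (Suc i))"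
    then obtain i x where i: "i < m" "y \<in> b (Suc i)" and x: "x \<in> A" "x \<in> b i"
      unfolding I_def by blast
    have "i * q + q \<le> m * q" using i mult_le_mono1[of "Suc i" m q] by simp
    then have "y \<in> {M + q<..M + q + k}"
      using i kmq unfolding b_def by auto
    moreover have "y \<in> {x..x + 2 * q}"
      using i x unfolding b_def by auto
    ultimately show "y \<in> (\<Union>x\<in>A. {x..x + 2 * q}) \<inter> {M + q<..M + q + k}"
      using x by blast
  qed
  then have "card (\<Union>i\<in>I. b (Suc i)) \<le> card ((\<Union>x\<in>A. {x..x + 2 * q}) \<inter> {M + q<..M + q + k})"
    by (intro card_mono) auto
  moreover have "card (\<Union>i\<in>I. b (Suc i)) = (\<Sum>i\<in>I. card (b (Suc i)))"
    unfolding b_def using I disjoint_blocks[of "Suc _" "Suc _"]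
    by (intro card_UN_disjoint) (auto simp del: mult_Suc)
  ultimately have "card I * q \<le> card ((\<Union>x\<in>A. {x..x + 2 * q}) \<inter> {M + q<..M + q + k})"
    by (simp add: b_def)
  then have "u * real (card I * q) \<le> u * real (card ((\<Union>x\<in>A. {x..x + 2 * q}) \<inter> {M + q<..M + q + k}))"
    using u0 by (intro mult_left_mono of_nat_mono)
  with le show ?thesis by linarith
qed

text \<open>Let \<open>\<eta>\<close> be the supremum of the densities of thickenings. Some
  thickening nearly attains it while no long window exceeds it by much, so its points are spread
  over almost all blocks, and one more thickening fills these.\<close>

lemma dense_thicken:
  assumes A: "window_dense c A" and c: "c > 0" and \<epsilon>: "\<epsilon> > 0"
  obtains L where "window_dense (1 - \<epsilon>) (thicken L A)"
proof -
  define S where "S = {c. \<exists>L. window_dense c (thicken L A)}"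
  have "c \<in> S"
    using A unfolding S_def by (auto simp: thicken_def intro!: exI[of _ 0])
  have bdd: "bdd_above S"
    unfolding S_def bdd_above_def using window_dense_le_1 by blast
  define \<eta> where "\<eta> = Sup S"
  have \<eta>: "\<eta> > 0"
    using cSup_upper[OF \<open>c \<in> S\<close> bdd] c unfolding \<eta>_def by simp
  \<comment> \<open>This makes \<open>(\<eta> + e) * (1 - \<epsilon>) \<le> \<eta> - 2 * e\<close>:
    one \<open>e\<close> pays for approximating the supremum, the other for the boundary term
    \<open>q \<le> e * k\<close>.\<close>
  define e where "e = \<epsilon> * \<eta> / 3"
  have e: "e > 0" using \<epsilon> \<eta> by (simp add: e_def)
  obtain c1 where "c1 \<in> S" "c1 > \<eta> - e"
    using less_cSupE[of "\<eta> - e" S] \<open>c \<in> S\<close> e unfolding \<eta>_def by (metis diff_less_eq empty_iff less_add_same_cancel1)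
  then obtain L where L: "window_dense c1 (thicken L A)"
    unfolding S_def by blast
  \<comment> \<open>Density \<open>\<eta> + e\<close> lies beyond the supremum, so from some length
    \<open>q0\<close> on all windows stay below it.\<close>
  have "\<not> window_dense (\<eta> + e) (thicken L A)"
    using cSup_upper[OF _ bdd, of "\<eta> + e"] e unfolding \<eta>_def S_def by auto
  then obtain q0 where q0: "\<And>k M. k \<ge> q0 \<Longrightarrow>
      real (card (thicken L A \<inter> {M<..M + k})) \<le> (\<eta> + e) * real k"
    unfolding window_dense_def by (meson linear)
  define q where "q = Suc q0"
  have q: "q > 0" "\<And>M. real (card (thicken L A \<inter> {M<..M + q})) \<le> (\<eta> + e) * real q"
    using q0[of q] by (simp_all add: q_def)
  have "window_dense (1 - \<epsilon>) (thicken (L + 2 * q) A)"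
    unfolding window_dense_def
  proof
    fix K
    define K' where "K' = max K (nat \<lceil>real q / e\<rceil>)"
    obtain k M where k: "k \<ge> K'" "c1 * real k \<le> real (card (thicken L A \<inter> {M<..M + k}))"
      using L unfolding window_dense_def by blast
    have "real q / e \<le> real k"
      using k(1) unfolding K'_def by linarith
    then have qk: "real q \<le> e * real k"
      using e by (simp add: field_simps)
    let ?X = "(\<Union>x\<in>thicken L A. {x..x + 2 * q}) \<inter> {M + q<..M + q + k}"
    let ?Y = "thicken (L + 2 * q) A \<inter> {M + q<..M + q + k}"
    have "?X \<subseteq> ?Y"
      using thicken_add by fastforce
    then have "card ?X \<le> card ?Y"
      by (intro card_mono) auto
    then have "(\<eta> + e) * real (card ?X) \<le> (\<eta> + e) * real (card ?Y)"
      using \<eta> e by (intro mult_left_mono) auto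
    then have le: "c1 * real k - real q \<le> (\<eta> + e) * real (card ?Y)"
      using card_thicken_window[OF q k(2)] by linarith
    have "(\<eta> + e) * ((1 - \<epsilon>) * real k) \<le> (\<eta> - 2 * e) * real k"
    proof -
      have "(\<eta> + e) * (1 - \<epsilon>) = \<eta> - 2 * e - e * \<epsilon>"
        by (simp add: e_def field_simps)
      also have "\<dots> \<le> \<eta> - 2 * e" using e \<epsilon> by simp
      finally show ?thesis
        by (metis mult.assoc mult_right_mono of_nat_0_le_iff)
    qed
    also have "\<dots> = (\<eta> - e) * real k - e * real k"
      by (simp add: algebra_simps)
    also have "\<dots> \<le> c1 * real k - real q"
      using \<open>c1 > \<eta> - e\<close> qk by (intro diff_mono mult_right_mono) auto
    also note le
    finally have "(1 - \<epsilon>) * real k \<le> real (card ?Y)"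
      using \<eta> e by (simp add: mult_le_cancel_left)
    then show "\<exists>k\<ge>K. \<exists>M. (1 - \<epsilon>) * real k \<le> real (card (thicken (L + 2 * q) A \<inter> {M<..M + k}))"
      using k(1) unfolding K'_def by (intro exI[of _ k] conjI exI[of _ "M + q"]) auto
  qed
  then show thesis using that by blast
qed

lemma dense_if_upper_Banach_density_pos:
  assumes "upper_Banach_density A > 0"
  obtains c where "c > 0" "window_dense c A"
proof -
  obtain y where y: "0 < y" "y < upper_Banach_density A"
    using dense[OF assms] by blast
  then obtain c where c: "ereal c \<le> y" "c > 0"
    by (metis ereal_dense2 ereal_less(2) less_imp_le)
  let ?f = "\<lambda>(k, M). ereal ((real (counting A (M + k - 1)) - real (counting A M)) / real k)"
  have freq: "\<exists>\<^sub>F p in at_top \<times>\<^sub>F at_top. c < ?f p"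
  proof (rule ccontr)
    assume "\<not> ?thesis"
    then have "\<forall>\<^sub>F p in at_top \<times>\<^sub>F at_top. ?f p \<le> c"
      by (simp add: not_frequently not_less)
    then have "upper_Banach_density A \<le> c"
      unfolding upper_Banach_density_def by (rule Limsup_bounded)
    with c y show False by (metis leD order_trans less_le_trans)
  qed
  have "window_dense c A"
    unfolding window_dense_def
  proof
    fix K
    have "\<forall>\<^sub>F p in (at_top :: nat filter) \<times>\<^sub>F (at_top :: nat filter). fst p \<ge> max K 1 \<and> snd p \<ge> 0"
      by (intro eventually_prodI eventually_ge_at_top)
    with freq have "\<exists>\<^sub>F p in at_top \<times>\<^sub>F at_top. c < ?f p \<and> fst p \<ge> max K 1 \<and> snd p \<ge> 0"
      by (rule frequently_eventually_frequently)
    then obtain k M where k: "k \<ge> K" "k \<ge> 1"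
      and lt: "c < (real (counting A (M + k - 1)) - real (counting A M)) / real k"
      by (auto dest!: frequently_ex)
    \<comment> \<open>The difference of counts sees only the \<open>k - 1\<close> points of
      \<open>{M<..M + k - 1}\<close>; the window of length \<open>k\<close> contains them.\<close>
    have "counting A (M + k - 1) \<le> card ((A \<inter> {1..M}) \<union> (A \<inter> {M<..M + k}))"
      unfolding counting_def by (intro card_mono) auto
    also have "\<dots> \<le> counting A M + card (A \<inter> {M<..M + k})"
      unfolding counting_def by (rule card_Un_le)
    finally have "real (counting A (M + k - 1)) - real (counting A M) \<le> real (card (A \<inter> {M<..M + k}))"
      by simp
    moreover have "c * real k < real (counting A (M + k - 1)) - real (counting A M)"
      using lt k by (simp add: field_simps)
    ultimately show "\<exists>k\<ge>K. \<exists>M. c * real k \<le> real (card (A \<inter> {M<..M + k}))"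
      using k by (intro exI[of _ k] conjI exI[of _ M]) auto
  qed
  with c show thesis using that by blast
qed

section \<open>Hausdorff measure of invariant sets\<close>

text \<open>For \<open>F\<close> inside the circle the floor encodes the first \<open>n\<close>
  binary digits, so these are the initial words of length \<open>n\<close> of points of
  \<open>F\<close>.\<close>

definition cells :: "nat \<Rightarrow> real set \<Rightarrow> int set" where
  "cells n F = (\<lambda>x. \<lfloor>2 ^ n * x\<rfloor>) ` F"

lemma finite_cells:
  assumes "F \<subseteq> circle"
  shows "finite (cells n F)"
proof (rule finite_subset)
  show "cells n F \<subseteq> {0..2 ^ n}"
  proof
    fix c assume "c \<in> cells n F"
    then obtain x :: real where x: "0 \<le> x" "x < 1" "c = \<lfloor>2 ^ n * x\<rfloor>"
      using assms unfolding cells_def circle_def by force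
    then have "2 ^ n * x \<le> real_of_int (2 ^ n)"
      by (simp add: mult_left_le)
    then have "c \<le> 2 ^ n"
      unfolding x(3) by linarith
    with x show "c \<in> {0..2 ^ n}" by simp
  qed
qed simp

lemma times2_invariant_pow:
  assumes "times2_invariant F" "x \<in> F"
  shows "frac (2 ^ k * x) \<in> F"
proof (induction k)
  case 0
  then show ?case
    using assms unfolding times2_invariant_def circle_def by (auto simp: frac_eq)
next
  case (Suc k)
  have "2 ^ Suc k * x = 2 * frac (2 ^ k * x) + real_of_int (2 * \<lfloor>2 ^ k * x\<rfloor>)"
    by (simp add: frac_def algebra_simps)
  then have "frac (2 ^ Suc k * x) = frac (2 * frac (2 ^ k * x))"
    by (metis add.commute frac_add_of_int_right)
  with Suc assms(1) show ?case
    unfolding times2_invariant_def by auto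
qed

section \<open>Covers of small weight and sets of measure zero\<close>

lemma hausdorff_premeasure_eq_0_cover:
  assumes "hausdorff_premeasure s \<delta> E = 0" "e > 0"
  obtains U :: "nat \<Rightarrow> 'a::metric_space set" where "E \<subseteq> (\<Union>n. U n)" "\<And>n. bounded (U n)" "\<And>n. diameter (U n) \<le> \<delta>"
    "(\<Sum>n. diam_weight s (U n)) < e"
proof -
  have "Inf {\<Sum>n. diam_weight s (U n) | U :: nat \<Rightarrow> 'a set.
            E \<subseteq> (\<Union>n. U n) \<and> (\<forall>n. bounded (U n) \<and> diameter (U n) \<le> \<delta>)} < e"
    using assms unfolding hausdorff_premeasure_def by simp
  then show thesis
    unfolding Inf_less_iff using that by blast
qed

lemma hausdorff_measure_eq_0_premeasure:
  assumes "hausdorff_measure s E = 0" "\<delta> > 0"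
  shows "hausdorff_premeasure s \<delta> E = 0"
proof -
  have "hausdorff_premeasure s \<delta> E \<le> hausdorff_measure s E"
    unfolding hausdorff_measure_def using assms(2) by (intro SUP_upper) simp
  with assms(1) show ?thesis by simp
qed

lemma hausdorff_measure_mono:
  assumes "E \<subseteq> E'"
  shows "hausdorff_measure s E \<le> hausdorff_measure s E'"
  unfolding hausdorff_measure_def hausdorff_premeasure_def
  using assms by (intro SUP_mono' Inf_superset_mono) blast

text \<open>Nonempty sets have weight \<open>1\<close> for \<open>s = 0\<close>, so a cover of total
  weight below \<open>1\<close> consists of empty sets.\<close>

lemma hausdorff_measure_0_eq_0:
  assumes "hausdorff_measure 0 E = 0"
  shows "E = {}"
proof -
  obtain U where U: "E \<subseteq> (\<Union>n. U n)" "(\<Sum>n. diam_weight 0 (U n)) < 1"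
    using hausdorff_premeasure_eq_0_cover[OF hausdorff_measure_eq_0_premeasure[OF assms zero_less_one], of 1]
    by (metis zero_less_one)
  have "U n = {}" for n
  proof -
    have "diam_weight 0 (U n) \<le> (\<Sum>n. diam_weight 0 (U n))"
      using sum_le_suminf[of "\<lambda>n. diam_weight 0 (U n)" "{n}"] by simp
    also note U(2)
    finally show ?thesis
      by (auto simp: diam_weight_def split: if_splits)
  qed
  with U show ?thesis by simp
qed

text \<open>The smallest power of \<open>1 / 2\<close> strictly above \<open>d > 0\<close> is at
  most \<open>2 * d\<close>, and doubling costs at most a factor \<open>2\<close> because
  \<open>s \<le> 1\<close>. The term \<open>e\<close> serves the case \<open>d = 0\<close>.\<close>

lemma dyadic_scale:
  fixes d e s :: real
  assumes "0 \<le> d" "d < 1 / 2" "0 < e" "0 < s" "s \<le> 1"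
  obtains k :: nat where "k \<ge> 1" "d < (1 / 2) ^ k" "((1 / 2) ^ k) powr s \<le> 2 * d powr s + e"
proof (cases "d = 0")
  case True
  have "(\<lambda>k. ((1 / 2) ^ k) powr s) \<longlonglongrightarrow> 0 powr s"
    using assms by (intro tendsto_powr' tendsto_const LIMSEQ_realpow_zero) auto
  then have "\<forall>\<^sub>F k in sequentially. ((1 / 2) ^ k) powr s < e"
    using assms by (simp add: order_tendstoD)
  then obtain k where "k \<ge> 1" "((1 / 2) ^ k) powr s < e"
    using eventually_conj[OF _ eventually_ge_at_top[of 1]] by (metis (no_types, lifting) eventually_sequentially linear)
  with True that[of k] show thesis by simp
next
  case False
  obtain m where m: "(1 / 2) ^ m < d"
    using real_arch_pow_inv[of d "1 / 2"] assms False by auto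
  define j where "j = (LEAST j. (1 / 2 :: real) ^ j \<le> d)"
  have j: "(1 / 2) ^ j \<le> d"
    unfolding j_def using LeastI[of "\<lambda>j. (1 / 2 :: real) ^ j \<le> d" m] m by simp
  have "j \<noteq> 0" "j \<noteq> 1"
    by (rule notI; use j assms in simp)+
  then obtain k where k: "j = Suc k" "k \<ge> 1"
    by (cases j) auto
  then have "d < (1 / 2) ^ k"
    using not_less_Least[of k "\<lambda>j. (1 / 2 :: real) ^ j \<le> d"] unfolding j_def[symmetric] by simp
  moreover have "((1 / 2) ^ k) powr s \<le> (2 * d) powr s"
    using j k assms by (intro powr_mono2) auto
  moreover have "(2 * d) powr s \<le> 2 * d powr s"
    using assms powr_mono[of s 1 2] by (simp add: powr_mult mult_right_mono)
  ultimately show thesis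
    using k assms that[of k] by simp
qed

section \<open>Counting the words of invariant sets of measure zero\<close>

text \<open>Each ball of radius \<open>2\<^sup>-\<^sup>k\<close> meets at most three dyadic cells of level \<open>k\<close>, and blowing such a cell up by
  \<open>2\<^sup>k\<close> maps the part of \<open>F\<close> in it into \<open>F\<close>.\<close>

lemma card_cells_recursion:
  assumes F: "times2_invariant F" and J: "finite J"
    and cover: "F \<subseteq> (\<Union>i\<in>J. ball (u i) ((1 / 2) ^ k i))" and kn: "\<And>i. i \<in> J \<Longrightarrow> k i \<le> n"
  shows "card (cells n F) \<le> (\<Sum>i\<in>J. 3 * card (cells (n - k i) F))"
proof -
  have fin: "finite (cells m F)" for m
    using F finite_cells unfolding times2_invariant_def by blast
  \<comment> \<open>\<open>P i c\<close> consists of indices of level-\<open>n\<close> cells inside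
    the level-\<open>k i\<close> cell at offset \<open>c\<close> from that of \<open>u i\<close>,
    the remaining \<open>n - k i\<close> digits being a word of \<open>F\<close>.\<close>
  define P where "P i c = (\<lambda>b. (\<lfloor>2 ^ k i * u i\<rfloor> + c) * 2 ^ (n - k i) + b) ` cells (n - k i) F" for i c
  have "cells n F \<subseteq> (\<Union>i\<in>J. \<Union>c\<in>{-1, 0, 1}. P i c)"
  proof
    fix z assume "z \<in> cells n F"
    then obtain x where x: "x \<in> F" "z = \<lfloor>2 ^ n * x\<rfloor>"
      unfolding cells_def by auto
    then obtain i where i: "i \<in> J" "dist (u i) x < (1 / 2) ^ k i"
      using cover by auto
    have "\<bar>2 ^ k i * u i - 2 ^ k i * x\<bar> = 2 ^ k i * dist (u i) x"
      by (simp add: dist_real_def abs_mult flip: right_diff_distrib)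
    also have "\<dots> < 2 ^ k i * (1 / 2) ^ k i"
      using i by (intro mult_strict_left_mono) auto
    also have "\<dots> = 1" by (simp flip: power_mult_distrib)
    finally have lt: "\<bar>2 ^ k i * u i - 2 ^ k i * x\<bar> < 1" .
    define c where "c = \<lfloor>2 ^ k i * x\<rfloor> - \<lfloor>2 ^ k i * u i\<rfloor>"
    have "c \<in> {-1, 0, 1}"
      using lt unfolding c_def by (simp, linarith)
    define y where "y = frac (2 ^ k i * x)"
    have "y \<in> F" using times2_invariant_pow[OF F x(1)] by (simp add: y_def)
    have "2 ^ n * x = 2 ^ (n - k i) * (2 ^ k i * x)"
      using kn[OF i(1)] by (simp flip: power_add mult.assoc)
    also have "\<dots> = 2 ^ (n - k i) * y + real_of_int (2 ^ (n - k i) * \<lfloor>2 ^ k i * x\<rfloor>)"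
      by (simp add: y_def frac_def algebra_simps)
    finally have "z = \<lfloor>2 ^ (n - k i) * y\<rfloor> + 2 ^ (n - k i) * \<lfloor>2 ^ k i * x\<rfloor>"
      unfolding x(2) by (metis floor_add_int)
    then have "z = (\<lfloor>2 ^ k i * u i\<rfloor> + c) * 2 ^ (n - k i) + \<lfloor>2 ^ (n - k i) * y\<rfloor>"
      by (simp add: c_def)
    then have "z \<in> P i c"
      using \<open>y \<in> F\<close> unfolding P_def cells_def by blast
    with i \<open>c \<in> {-1, 0, 1}\<close> show "z \<in> (\<Union>i\<in>J. \<Union>c\<in>{-1, 0, 1}. P i c)" by blast
  qed
  moreover have finP: "finite (P i c)" "card (P i c) \<le> card (cells (n - k i) F)" for i c
    unfolding P_def using fin by (auto intro: card_image_le)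
  ultimately have "card (cells n F) \<le> card (\<Union>i\<in>J. \<Union>c\<in>{-1, 0, 1}. P i c)"
    using J by (intro card_mono finite_UN_I) auto
  also have "\<dots> \<le> (\<Sum>i\<in>J. card (\<Union>c\<in>{-1, 0, 1}. P i c))"
    by (rule card_UN_le[OF J])
  also have "\<dots> \<le> (\<Sum>i\<in>J. 3 * card (cells (n - k i) F))"
  proof (rule sum_mono)
    fix i
    have "card (\<Union>c\<in>{-1, 0, 1}. P i c) \<le> (\<Sum>c\<in>{-1, 0, 1}. card (P i c))"
      by (rule card_UN_le) simp
    also have "\<dots> \<le> (\<Sum>c\<in>{-1, 0, 1 :: int}. card (cells (n - k i) F))"
      by (rule sum_mono) (rule finP)
    finally show "card (\<Union>c\<in>{-1, 0, 1}. P i c) \<le> 3 * card (cells (n - k i) F)" by simp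
  qed
  finally show ?thesis .
qed

text \<open>Strong induction along \<open>card_cells_recursion\<close>: inserting the bound for the
  lengths \<open>n - k i\<close> reproduces it for \<open>n\<close>, multiplied by a total weight of
  at most \<open>1\<close>.\<close>

lemma card_cells_growth:
  assumes F: "times2_invariant F" and J: "finite J"
    and cover: "F \<subseteq> (\<Union>i\<in>J. ball (u i) ((1 / 2) ^ k i))" and k: "\<And>i. i \<in> J \<Longrightarrow> k i \<ge> 1"
    and s: "s \<ge> 0" and weight: "(\<Sum>i\<in>J. 3 * ((1 / 2) ^ k i) powr s) \<le> 1"
  obtains C where "\<And>n. real (card (cells n F)) \<le> C * (2 ^ n) powr s"
proof -
  define K where "K = Max (insert 0 (k ` J))"
  have K: "k i \<le> K" if "i \<in> J" for i
    unfolding K_def using J that by (intro Max_ge) auto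
  \<comment> \<open>\<open>C\<close> bounds the counts for all lengths below \<open>K\<close>; from
    \<open>K\<close> on every \<open>k i\<close> is at most \<open>n\<close>, and the recursion
    applies.\<close>
  define C where "C = real (\<Sum>n<K. card (cells n F))"
  have C0: "C \<ge> 0" by (simp add: C_def sum_nonneg)
  have "real (card (cells n F)) \<le> C * (2 ^ n) powr s" for n
  proof (induction n rule: less_induct)
    case (less n)
    show ?case
    proof (cases "n < K")
      case True
      then have "card (cells n F) \<le> (\<Sum>n<K. card (cells n F))"
        by (intro member_le_sum) auto
      then have "real (card (cells n F)) \<le> C * 1"
        unfolding C_def by linarith
      also have "\<dots> \<le> C * (2 ^ n) powr s"
        using C0 s by (intro mult_left_mono ge_one_powr_ge_zero) auto
      finally show ?thesis .
    next
      case False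
      then have kn: "k i \<le> n" if "i \<in> J" for i
        using K[OF that] by simp
      have "real (card (cells n F)) \<le> (\<Sum>i\<in>J. 3 * real (card (cells (n - k i) F)))"
        using of_nat_mono[OF card_cells_recursion[OF F J cover kn], where 'a = real] by simp
      also have "\<dots> \<le> (\<Sum>i\<in>J. 3 * (C * (2 ^ (n - k i)) powr s))"
        using k kn by (intro sum_mono mult_left_mono less) force+
      also have "\<dots> = (\<Sum>i\<in>J. C * (2 ^ n) powr s * (3 * ((1 / 2) ^ k i) powr s))"
      proof (rule sum.cong)
        fix i assume "i \<in> J"
        then have "(2 :: real) ^ (n - k i) = 2 ^ n * (1 / 2) ^ k i"
          using kn by (simp add: power_diff power_divide)
        then show "3 * (C * (2 ^ (n - k i)) powr s) = C * (2 ^ n) powr s * (3 * ((1 / 2) ^ k i) powr s)"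
          by (simp add: powr_mult)
      qed simp
      also have "\<dots> = C * (2 ^ n) powr s * (\<Sum>i\<in>J. 3 * ((1 / 2) ^ k i) powr s)"
        by (simp add: sum_distrib_left)
      also have "\<dots> \<le> C * (2 ^ n) powr s * 1"
        using weight C0 by (intro mult_left_mono) auto
      finally show ?thesis by simp
    qed
  qed
  then show thesis using that by blast
qed

text \<open>Enlarging the covering sets to open balls of dyadic radius lets compactness select a
  finite cover, to which \<open>card_cells_growth\<close> applies.\<close>

lemma closed_invariant_null_cells_growth:
  assumes closed: "circle_closed F" and inv: "times2_invariant F"
    and s: "0 < s" "s \<le> 1" and null: "hausdorff_measure s F = 0"
  obtains C where "\<And>n. real (card (cells n F)) \<le> C * (2 ^ n) powr s"
proof -
  \<comment> \<open>The budget: \<open>2 / 24\<close> from the diameters, \<open>2 / 24\<close> from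
    the geometric error terms and \<open>1 / 24\<close> for an extra ball; three times
    \<open>5 / 24\<close> is below \<open>1\<close>.\<close>
  obtain U where U: "F \<subseteq> (\<Union>n. U n)" "\<And>n. bounded (U n)" "\<And>n. diameter (U n) \<le> 1 / 4"
    and small: "(\<Sum>n. diam_weight s (U n)) < ennreal (1 / 24)"
    using hausdorff_premeasure_eq_0_cover[OF hausdorff_measure_eq_0_premeasure[OF null, of "1 / 4"], of "ennreal (1 / 24)"]
    by auto
  define d where "d n = diameter (U n) powr s" for n
  have weight: "ennreal (if U n = {} then 0 else d n) = diam_weight s (U n)" for n
    using s by (simp add: diam_weight_def d_def)
  have d_sum: "(\<Sum>n\<in>J. d n) \<le> 1 / 24" if J: "finite J" "\<And>n. n \<in> J \<Longrightarrow> U n \<noteq> {}" for J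
  proof -
    have "ennreal (\<Sum>n\<in>J. d n) = (\<Sum>n\<in>J. diam_weight s (U n))"
      using J by (simp add: d_def flip: weight sum_ennreal)
    also have "\<dots> \<le> (\<Sum>n. diam_weight s (U n))"
      using J by (intro sum_le_suminf) auto
    also note small
    finally show ?thesis
      by (simp add: ennreal_less_iff d_def sum_nonneg less_imp_le)
  qed
  have "\<exists>k\<ge>1. diameter (U n) < (1 / 2) ^ k \<and> ((1 / 2) ^ k) powr s \<le> 2 * d n + (1 / 2) ^ n / 24" for n
  proof -
    have "0 \<le> diameter (U n)" "diameter (U n) < 1 / 2"
      using U(2,3)[of n] diameter_ge_0[of "U n"] by auto
    then show ?thesis
      using dyadic_scale[of "diameter (U n)" "(1 / 2) ^ n / 24" s] s unfolding d_def by auto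
  qed
  then obtain k where k: "\<And>n. k n \<ge> 1" "\<And>n. diameter (U n) < (1 / 2) ^ k n"
      "\<And>n. ((1 / 2) ^ k n) powr s \<le> 2 * d n + (1 / 2) ^ n / 24"
    by metis
  obtain k0 :: nat where k0: "k0 \<ge> 1" "((1 / 2) ^ k0) powr s \<le> 1 / 24"
    using dyadic_scale[of 0 "1 / 24" s] s by auto
  define N where "N = {n. U n \<noteq> {}}"
  define u where "u n = (SOME x. x \<in> U n)" for n
  have u: "u n \<in> U n" if "n \<in> N" for n
    using that unfolding N_def u_def by (auto intro: someI)
  \<comment> \<open>\<open>F\<close> may accumulate at \<open>1\<close> and then is not compact in
    the reals. The compact set \<open>?K\<close> also contains \<open>1\<close> if
    \<open>0 \<in> F\<close>; the given cover need not reach that point, so it gets its own ball,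
    with index \<open>None\<close>.\<close>
  define B where "B i = (case i of None \<Rightarrow> ball (1 :: real) ((1 / 2) ^ k0) | Some n \<Rightarrow> ball (u n) ((1 / 2) ^ k n))" for i
  let ?K = "frac -` F \<inter> {0..1}"
  have "compact ?K"
    using closed unfolding circle_closed_def by (intro closed_Int_compact) auto
  moreover have "open (B i)" for i
    by (cases i) (auto simp: B_def)
  moreover have "?K \<subseteq> (\<Union>i\<in>insert None (Some ` N). B i)"
  proof
    fix x assume x: "x \<in> ?K"
    show "x \<in> (\<Union>i\<in>insert None (Some ` N). B i)"
    proof (cases "x = 1")
      case True
      then show ?thesis by (auto simp: B_def)
    next
      case False
      with x have "frac x = x" by (simp add: frac_eq)
      with x have "x \<in> F" by simp
      then obtain n where n: "x \<in> U n" using U(1) by blast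
      then have "n \<in> N" unfolding N_def by blast
      have "dist (u n) x \<le> diameter (U n)"
        using diameter_bounded_bound[OF U(2) u[OF \<open>n \<in> N\<close>] n] .
      also note k(2)[of n]
      finally have "x \<in> B (Some n)" by (simp add: B_def)
      with \<open>n \<in> N\<close> show ?thesis by blast
    qed
  qed
  ultimately obtain J' where J': "J' \<subseteq> insert None (Some ` N)" "finite J'" "?K \<subseteq> (\<Union>i\<in>J'. B i)"
    by (rule compactE_image)
  define J where "J = {n. Some n \<in> J'}"
  have J: "finite J" "J \<subseteq> N"
  proof -
    have "J = Some -` J'" by (auto simp: J_def)
    then show "finite J" using J'(2) by (simp add: finite_vimageI)
    show "J \<subseteq> N" using J'(1) by (auto simp: J_def)
  qed
  define c where "c i = (case i of None \<Rightarrow> 1 | Some n \<Rightarrow> u n)" for i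
  define l where "l i = (case i of None \<Rightarrow> k0 | Some n \<Rightarrow> k n)" for i
  have B: "B i = ball (c i) ((1 / 2) ^ l i)" for i
    by (cases i) (auto simp: B_def c_def l_def)
  have "F \<subseteq> ?K"
    using inv unfolding times2_invariant_def circle_def by (force simp: frac_eq[THEN iffD2])
  have cover: "F \<subseteq> (\<Union>i\<in>insert None (Some ` J). ball (c i) ((1 / 2) ^ l i))"
  proof -
    have "J' \<subseteq> insert None (Some ` J)"
      using J'(1) by (auto simp: J_def)
    then have "(\<Union>i\<in>J'. B i) \<subseteq> (\<Union>i\<in>insert None (Some ` J). B i)"
      by (rule UN_mono) (rule order_refl)
    with \<open>F \<subseteq> ?K\<close> J'(3) show ?thesis
      unfolding B by (meson order_trans)
  qed
  have geo: "(\<Sum>n\<in>J. (1 / 2 :: real) ^ n) \<le> 2"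
    using sum_le_suminf[of "\<lambda>n. (1 / 2 :: real) ^ n" J] J by (simp add: suminf_geometric)
  have "(\<Sum>n\<in>J. ((1 / 2) ^ k n) powr s) \<le> (\<Sum>n\<in>J. 2 * d n + (1 / 2) ^ n / 24)"
    by (intro sum_mono k)
  also have "\<dots> = 2 * (\<Sum>n\<in>J. d n) + (\<Sum>n\<in>J. (1 / 2) ^ n) / 24"
    by (simp add: sum.distrib sum_distrib_left sum_divide_distrib)
  also have "\<dots> \<le> 2 * (1 / 24) + 2 / 24"
    using d_sum[OF J(1)] J(2) geo unfolding N_def by (intro add_mono mult_left_mono divide_right_mono) auto
  finally have "(\<Sum>i\<in>insert None (Some ` J). 3 * ((1 / 2) ^ l i) powr s) \<le> 1"
    using J k0 by (simp add: sum.reindex l_def flip: sum_distrib_left)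
  moreover have "l i \<ge> 1" for i
    using k k0 by (cases i) (auto simp: l_def)
  ultimately show thesis
    using card_cells_growth[OF inv _ cover, of s] J s that by auto
qed

text \<open>Covering by \<open>m\<close> intervals of length \<open>1 / m\<close> has total weight
  \<open>m powr (1 - s)\<close>, which tends to \<open>0\<close>.\<close>

lemma hausdorff_measure_circle_eq_0:
  assumes s: "s > 1"
  shows "hausdorff_measure s circle = 0"
proof -
  have "hausdorff_premeasure s \<delta> circle \<le> 0" if \<delta>: "\<delta> > 0" for \<delta>
  proof -
    have le: "hausdorff_premeasure s \<delta> circle \<le> ennreal (real m powr (1 - s))" if m: "m \<ge> 1" "1 / real m \<le> \<delta>" for m :: nat
    proof -
      define U where "U n = (if n < m then {real n / real m..real (Suc n) / real m} else {})" for n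
      have diam: "diameter (U n) = 1 / real m" if "n < m" for n
        using that m by (simp add: U_def divide_right_mono field_simps)
      have "circle \<subseteq> (\<Union>n. U n)"
      proof
        fix x assume "x \<in> circle"
        then have x: "0 \<le> x" "x < 1" by (auto simp: circle_def)
        define n where "n = nat \<lfloor>real m * x\<rfloor>"
        have n: "real n \<le> real m * x" "real m * x < real n + 1"
          using x unfolding n_def by (auto simp: of_nat_nat)
        have "real m * x < real m * 1"
          using x m by (intro mult_strict_left_mono) auto
        with n have "n < m" by linarith
        with n m have "x \<in> U n" by (simp add: U_def field_simps)
        then show "x \<in> (\<Union>n. U n)" by blast
      qed
      moreover have "\<forall>n. bounded (U n) \<and> diameter (U n) \<le> \<delta>"
        using diam m \<delta> by (auto simp: U_def)
      ultimately have "hausdorff_premeasure s \<delta> circle \<le> (\<Sum>n. diam_weight s (U n))"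
        unfolding hausdorff_premeasure_def by (intro Inf_lower) blast
      also have "\<dots> = (\<Sum>n<m. diam_weight s (U n))"
        by (rule suminf_finite) (auto simp: U_def diam_weight_def)
      also have "\<dots> = (\<Sum>n<m. ennreal ((1 / real m) powr s))"
        using diam s by (intro sum.cong) (auto simp: diam_weight_def U_def divide_right_mono)
      also have "\<dots> = ennreal (real m * (1 / real m) powr s)"
        by (simp add: ennreal_mult ennreal_of_nat_eq_real_of_nat)
      also have "real m * (1 / real m) powr s = real m powr (1 - s)"
        using m by (simp add: powr_diff powr_divide)
      finally show ?thesis .
    qed
    have "(\<lambda>m. ennreal (real m powr (1 - s))) \<longlonglongrightarrow> ennreal 0"
      using s by (intro tendsto_ennrealI tendsto_neg_powr filterlim_real_sequentially) auto
    moreover have "\<forall>\<^sub>F m in sequentially. hausdorff_premeasure s \<delta> circle \<le> ennreal (real m powr (1 - s))"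
    proof (rule eventually_sequentiallyI)
      fix m assume m: "m \<ge> max 1 (nat \<lceil>1 / \<delta>\<rceil>)"
      then have "1 / \<delta> \<le> real m" by linarith
      then have "1 / real m \<le> \<delta>"
        using \<delta> m by (simp add: field_simps)
      with m show "hausdorff_premeasure s \<delta> circle \<le> ennreal (real m powr (1 - s))"
        by (intro le) auto
    qed
    ultimately show ?thesis
      using tendsto_lowerbound by fastforce
  qed
  then have "hausdorff_measure s circle \<le> 0"
    unfolding hausdorff_measure_def by (intro SUP_least) auto
  then show ?thesis by simp
qed

section \<open>Digit sets without long progressions\<close>

text \<open>Defined on all reals, so that sums and doubles can be studied before reduction modulo
  \<open>1\<close>: for \<open>i \<ge> 1\<close> an integer summand changes \<open>2 ^ i * x\<close>
  by an even integer.\<close>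

definition ones :: "real \<Rightarrow> nat set" where
  "ones x = {i. i \<ge> 1 \<and> odd \<lfloor>2 ^ i * x\<rfloor>}"

lemma in_ones_iff: "i \<in> ones x \<longleftrightarrow> i \<ge> 1 \<and> binary_digit x i = 1"
  unfolding ones_def binary_digit_def by (simp add: odd_iff_mod_2_eq_one)

lemma ones_add_int: "ones (x + of_int m) = ones x"
proof -
  have "odd \<lfloor>2 ^ i * (x + of_int m)\<rfloor> \<longleftrightarrow> odd \<lfloor>2 ^ i * x\<rfloor>" if "i \<ge> 1" for i
  proof -
    have "2 ^ i * (x + of_int m) = 2 ^ i * x + real_of_int (2 ^ i * m)"
      by (simp add: algebra_simps)
    then have "\<lfloor>2 ^ i * (x + of_int m)\<rfloor> = \<lfloor>2 ^ i * x\<rfloor> + 2 ^ i * m"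
      by (metis floor_add_int)
    then show ?thesis using that by simp
  qed
  then show ?thesis unfolding ones_def by blast
qed

lemma ones_frac: "ones (frac x) = ones x"
  using ones_add_int[of x "- \<lfloor>x\<rfloor>"] by (simp add: frac_def)

lemma ones_double: "ones (2 * x) \<subseteq> {i. i + 1 \<in> ones x}"
  unfolding ones_def by (auto simp: mult_ac)

text \<open>A carry out of position \<open>i + 1\<close> requires a digit \<open>1\<close> at that position in one of the summands.\<close>

lemma ones_add: "ones (x + y) \<subseteq> (ones x \<union> ones y) \<union> {i. i + 1 \<in> ones x \<union> ones y}"
proof
  fix i assume i: "i \<in> ones (x + y)"
  \<comment> \<open>If the digits \<open>i\<close> and \<open>i + 1\<close> of \<open>z\<close>
    vanish, \<open>2 ^ i * z\<close> exceeds an even integer by less than \<open>1 / 2\<close>. Two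
    such numbers add up to less than \<open>1\<close> above an even integer.\<close>
  have *: "\<exists>p. real_of_int (2 * p) \<le> 2 ^ i * z \<and> 2 ^ i * z < real_of_int (2 * p) + 1 / 2"
    if z: "i \<notin> ones z" "i + 1 \<notin> ones z" for z
  proof -
    obtain p where p: "\<lfloor>2 ^ i * z\<rfloor> = 2 * p"
      using z(1) i unfolding ones_def by (auto elim: evenE)
    obtain r where r: "\<lfloor>2 * (2 ^ i * z)\<rfloor> = 2 * r"
      using z(2) unfolding ones_def by (auto elim!: evenE simp: mult.assoc)
    have "r = 2 * p" using p r by linarith
    with p r show ?thesis by (intro exI[of _ p]) linarith
  qed
  show "i \<in> (ones x \<union> ones y) \<union> {i. i + 1 \<in> ones x \<union> ones y}"
  proof (rule ccontr)
    assume "\<not> ?thesis"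
    then obtain p q where "real_of_int (2 * p) \<le> 2 ^ i * x" "2 ^ i * x < real_of_int (2 * p) + 1 / 2"
        "real_of_int (2 * q) \<le> 2 ^ i * y" "2 ^ i * y < real_of_int (2 * q) + 1 / 2"
      using *[of x] *[of y] by blast
    then have "\<lfloor>2 ^ i * (x + y)\<rfloor> = 2 * (p + q)"
      by (simp add: floor_eq_iff distrib_left)
    with i show False unfolding ones_def by simp
  qed
qed

lemma floor_pow2_coarsen:
  fixes x :: real
  assumes "i \<le> n"
  shows "\<lfloor>2 ^ i * x\<rfloor> = \<lfloor>2 ^ n * x\<rfloor> div 2 ^ (n - i)"
proof -
  have "(2 :: real) ^ n = 2 ^ i * 2 ^ (n - i)"
    using assms by (simp flip: power_add)
  then have "2 ^ i * x = 2 ^ n * x / real_of_int (2 ^ (n - i))"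
    by simp
  then show ?thesis by (metis floor_divide_real_eq_div zero_le_numeral zero_le_power)
qed

lemma ones_upto_cong:
  assumes "\<lfloor>2 ^ n * x\<rfloor> = \<lfloor>2 ^ n * y\<rfloor>"
  shows "ones x \<inter> {..n} = ones y \<inter> {..n}"
proof -
  have "\<lfloor>2 ^ i * x\<rfloor> = \<lfloor>2 ^ i * y\<rfloor>" if "i \<le> n" for i
    using that assms by (simp only: floor_pow2_coarsen)
  then show ?thesis unfolding ones_def by auto
qed

text \<open>Just to the left of a dyadic point the digits are not those of the point, but they contain a
  long run of ones.\<close>

lemma open_has_AP_ones: "open {z. has_AP l (ones z)}"
  unfolding open_dist
proof
  fix z assume "z \<in> {z. has_AP l (ones z)}"
  then obtain a d where d: "d > 0" and ad: "\<And>j. j < l \<Longrightarrow> a + j * d \<in> ones z"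
    unfolding has_AP_def by blast
  \<comment> \<open>No position of the progression exceeds \<open>n\<close>, so all points in the
    dyadic cell of level \<open>n\<close> around \<open>z\<close> share it.\<close>
  define n where "n = a + l * d"
  define q where "q = \<lfloor>2 ^ n * z\<rfloor>"
  have same: "has_AP l (ones y)" if y: "\<lfloor>2 ^ n * y\<rfloor> = q" for y
  proof -
    have "a + j * d \<in> ones y" if "j < l" for j
    proof -
      have "a + j * d \<le> n" using that by (simp add: n_def)
      with ad[OF that] ones_upto_cong[of n y z] y show ?thesis
        unfolding q_def by blast
    qed
    with d show ?thesis unfolding has_AP_def by blast
  qed
  have zq: "of_int q \<le> 2 ^ n * z" "2 ^ n * z < of_int q + 1"
    unfolding q_def by linarith+
  show "\<exists>e>0. \<forall>y. dist y z < e \<longrightarrow> y \<in> {z. has_AP l (ones z)}"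
  proof (cases "2 ^ n * z = of_int q")
    case False
    define e where "e = min (2 ^ n * z - of_int q) (of_int q + 1 - 2 ^ n * z) / 2 ^ n"
    have "e > 0" using False zq by (simp add: e_def)
    moreover have "has_AP l (ones y)" if "dist y z < e" for y
    proof (rule same)
      have "\<bar>2 ^ n * y - 2 ^ n * z\<bar> = 2 ^ n * dist y z"
        by (simp add: dist_real_def abs_mult flip: right_diff_distrib)
      also have "\<dots> < 2 ^ n * e" using that by simp
      also have "\<dots> = min (2 ^ n * z - of_int q) (of_int q + 1 - 2 ^ n * z)"
        by (simp add: e_def)
      finally show "\<lfloor>2 ^ n * y\<rfloor> = q"
        by (simp add: floor_eq_iff) linarith
    qed
    ultimately show ?thesis by auto
  next
    case True
    \<comment> \<open>Points this close on the right stay in the same cell; those on the left have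
      digit \<open>1\<close> at the positions \<open>n + 1\<close> to \<open>n + l\<close>, a
      progression of difference \<open>1\<close>.\<close>
    define e :: real where "e = (1 / 2) ^ (n + l)"
    have "e > 0" by (simp add: e_def)
    moreover have "has_AP l (ones y)" if "dist y z < e" for y
    proof -
      have yz: "\<bar>y - z\<bar> < e" using that by (simp add: dist_real_def)
      have dist: "\<bar>2 ^ (n + t) * y - 2 ^ t * of_int q\<bar> < 1" if "t \<le> l" for t
      proof -
        have "2 ^ (n + t) * y - 2 ^ t * of_int q = 2 ^ (n + t) * (y - z)"
          unfolding True[symmetric] by (simp add: power_add algebra_simps)
        then have "\<bar>2 ^ (n + t) * y - 2 ^ t * of_int q\<bar> = 2 ^ (n + t) * \<bar>y - z\<bar>"
          by (simp add: abs_mult)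
        also have "\<dots> < 2 ^ (n + t) * e" using yz by simp
        also have "\<dots> \<le> 2 ^ (n + l) * e"
          using that \<open>e > 0\<close> by (intro mult_right_mono power_increasing) auto
        also have "\<dots> = 1" unfolding e_def by (simp flip: power_mult_distrib)
        finally show ?thesis .
      qed
      show ?thesis
      proof (cases "y < z")
        case False
        then have "2 ^ n * z \<le> 2 ^ n * y" by simp
        with dist[of 0] True have "\<lfloor>2 ^ n * y\<rfloor> = q"
          by (simp add: floor_eq_iff)
        then show ?thesis by (rule same)
      next
        case left: True
        have "(n + 1) + j * 1 \<in> ones y" if "j < l" for j
        proof -
          have "2 ^ (n + Suc j) * y < 2 ^ (n + Suc j) * z" using left by simp
          also have "\<dots> = 2 ^ Suc j * of_int q"
            unfolding True[symmetric] by (simp add: power_add)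
          finally have "\<lfloor>2 ^ (n + Suc j) * y\<rfloor> = 2 ^ Suc j * q - 1"
            using dist[of "Suc j"] that by (simp add: floor_eq_iff)
          then show ?thesis unfolding ones_def by simp
        qed
        then show ?thesis unfolding has_AP_def by (meson zero_less_one)
      qed
    qed
    ultimately show ?thesis by auto
  qed
qed

section \<open>The semigroup of points with progression-free digit sets\<close>

definition AP_free :: "nat \<Rightarrow> real set" where
  "AP_free l = {x \<in> circle. \<not> has_AP l (ones x)}"

lemma circle_closed_AP_free: "circle_closed (AP_free l)"
proof -
  have "frac -` AP_free l = - {z. has_AP l (ones z)}"
    by (auto simp: AP_free_def ones_frac circle_def frac_ge_0 frac_lt_1)
  then show ?thesis
    unfolding circle_closed_def using open_has_AP_ones[of l]
    by (auto simp: AP_free_def closed_def)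
qed

lemma times2_invariant_AP_free: "times2_invariant (AP_free l)"
  unfolding times2_invariant_def
proof (intro conjI image_subsetI)
  show "AP_free l \<subseteq> circle" by (auto simp: AP_free_def)
  fix x assume x: "x \<in> AP_free l"
  have "\<not> has_AP l (ones (2 * x))"
    using x has_AP_vimage_add[of l 1 "ones x"] has_AP_mono[OF _ ones_double, of l x]
    by (auto simp: AP_free_def)
  then show "frac (2 * x) \<in> AP_free l"
    by (simp add: AP_free_def ones_frac circle_def frac_ge_0 frac_lt_1)
qed

text \<open>By \<open>ones_add\<close> the digits of the sum lie in
  \<open>ones x \<union> ones y\<close> and its shift by one. \<open>AP_free_Un\<close> handles
  first this union, then the union with the shift; \<open>max 1\<close> keeps the index in
  \<open>{1..}\<close>.\<close>

lemma circle_sum_AP_free: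
  "\<exists>N\<ge>1. circle_sum (AP_free i) (AP_free j) \<subseteq> AP_free N"
proof -
  obtain N1 where N1: "\<forall>X Y. \<not> has_AP i X \<longrightarrow> \<not> has_AP j Y \<longrightarrow> \<not> has_AP N1 (X \<union> Y)"
    using AP_free_Un ..
  obtain N2 where N2: "\<forall>X Y. \<not> has_AP N1 X \<longrightarrow> \<not> has_AP N1 Y \<longrightarrow> \<not> has_AP N2 (X \<union> Y)"
    using AP_free_Un ..
  have "\<not> has_AP (max 1 N2) (ones (x + y))" if "x \<in> AP_free i" "y \<in> AP_free j" for x y
  proof -
    have 1: "\<not> has_AP N1 (ones x \<union> ones y)"
      using that N1 unfolding AP_free_def by blast
    then have "\<not> has_AP N1 {i. i + 1 \<in> ones x \<union> ones y}"
      using has_AP_vimage_add by blast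
    with 1 N2 have "\<not> has_AP N2 ((ones x \<union> ones y) \<union> {i. i + 1 \<in> ones x \<union> ones y})"
      by blast
    then show ?thesis
      using has_AP_mono[OF _ ones_add] has_AP_antimono[of "max 1 N2" _ N2] by (meson max.cobounded2)
  qed
  then have "circle_sum (AP_free i) (AP_free j) \<subseteq> AP_free (max 1 N2)"
    unfolding circle_sum_def
    by (auto simp: AP_free_def ones_frac circle_def frac_ge_0 frac_lt_1)
  then show ?thesis by (meson max.cobounded1)
qed

text \<open>The ones of \<open>y\<close> lie in the translate of the ones of \<open>x\<close> by
  \<open>N\<close>.\<close>

lemma binary_subsequence_AP_free:
  assumes "binary_subsequence y x" "x \<in> AP_free l"
  shows "y \<in> AP_free l"
proof -
  obtain N where N: "\<forall>i\<ge>1. binary_digit y (i + N) = 1 \<longrightarrow> binary_digit x i = 1"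
      "\<forall>j\<in>{1..N}. binary_digit y j = 0" and y: "y \<in> circle"
    using assms(1) unfolding binary_subsequence_def by blast
  have "ones y \<subseteq> (\<lambda>i. i + N) ` ones x"
  proof
    fix i assume i: "i \<in> ones y"
    then have "i \<notin> {1..N}" using N(2) by (auto simp: in_ones_iff)
    then have "i - N \<ge> 1" "i = (i - N) + N" using i by (auto simp: in_ones_iff)
    with i N(1) have "i - N \<in> ones x" by (metis in_ones_iff)
    with \<open>i = (i - N) + N\<close> show "i \<in> (\<lambda>i. i + N) ` ones x" by blast
  qed
  then have "\<not> has_AP l (ones y)"
    using assms(2) has_AP_mono has_AP_image_add unfolding AP_free_def by blast
  with y show ?thesis by (simp add: AP_free_def)
qed

lemma erdos_semigroup_AP_free: "erdos_semigroup (\<Union>l\<in>{1..}. AP_free l)"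
proof -
  obtain W where W: "\<And>i j. W i j \<ge> 1 \<and> circle_sum (AP_free i) (AP_free j) \<subseteq> AP_free (W i j)"
    using circle_sum_AP_free by metis
  show ?thesis
    unfolding erdos_semigroup_def
    using circle_closed_AP_free times2_invariant_AP_free binary_subsequence_AP_free W
    by (intro exI[of _ AP_free] conjI exI[of _ W]) blast+
qed

text \<open>The number \<open>2 ^ (2 * t + 1) * (2 / 3)\<close> is \<open>4 ^ Suc t / 3\<close>,
  with odd integer part \<open>(4 ^ Suc t - 1) / 3\<close>.\<close>

lemma odd_in_ones_two_thirds: "2 * t + 1 \<in> ones (2 / 3)"
proof -
  have "\<exists>r. odd r \<and> 3 * r = 4 ^ Suc t - (1 :: int)"
  proof (induction t)
    case (Suc t)
    then obtain r where "odd r" "3 * r = 4 ^ Suc t - (1 :: int)" by blast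
    then have "odd (4 * r + 1) \<and> 3 * (4 * r + 1) = 4 ^ Suc (Suc t) - (1 :: int)" by simp
    then show ?case by blast
  qed (auto intro: exI[of _ 1])
  then obtain r where r: "odd r" "3 * r = 4 ^ Suc t - (1 :: int)" by blast
  have "real_of_int (3 * r) = 4 ^ Suc t - 1"
    unfolding r(2) by simp
  then have "2 ^ (2 * t + 1) * (2 / 3) = real_of_int r + 1 / 3"
    by (simp add: power_mult)
  then have "\<lfloor>2 ^ (2 * t + 1) * (2 / 3 :: real)\<rfloor> = r"
    by (simp add: floor_eq_iff)
  with r(1) show ?thesis unfolding ones_def by simp
qed

lemma two_thirds_not_AP_free: "2 / 3 \<notin> AP_free l"
proof -
  have "\<forall>j<l. 1 + j * 2 \<in> ones (2 / 3)"
    using odd_in_ones_two_thirds by (metis add.commute mult.commute)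
  then have "has_AP l (ones (2 / 3))"
    unfolding has_AP_def by (meson zero_less_numeral)
  then show ?thesis by (simp add: AP_free_def)
qed

lemma sum_half_powers_less:
  fixes i :: nat
  assumes "finite S" "S \<subseteq> {i<..}"
  shows "(\<Sum>j\<in>S. (1 / 2 :: real) ^ j) < (1 / 2) ^ i"
proof -
  define m where "m = Max (insert i S)"
  have m: "i \<le> m" "S \<subseteq> {i<..m}"
    using assms by (auto simp: m_def)
  have "(\<Sum>j\<in>S. (1 / 2 :: real) ^ j) \<le> (\<Sum>j\<in>{i<..m}. (1 / 2) ^ j)"
    using m by (intro sum_mono2) auto
  \<comment> \<open>Finiteness of \<open>S\<close> leaves the positive remainder
    \<open>(1 / 2) ^ m\<close>, which makes the bound strict.\<close>
  also have "\<dots> = (1 / 2) ^ i - (1 / 2) ^ m"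
    using m(1)
  proof (induction m rule: dec_induct)
    case (step m)
    then have "{i<..Suc m} = insert (Suc m) {i<..m}" by auto
    with step show ?case by simp
  qed simp
  also have "\<dots> < (1 / 2) ^ i" by simp
  finally show ?thesis .
qed

lemma dyadic_sum_in_circle:
  assumes "finite S" "S \<subseteq> {1..}"
  shows "(\<Sum>j\<in>S. (1 / 2 :: real) ^ j) \<in> circle"
proof -
  have "S \<subseteq> {0<..}" using assms(2) by force
  then show ?thesis
    using sum_half_powers_less[of S 0] assms(1) by (simp add: circle_def sum_nonneg)
qed

text \<open>After multiplication by \<open>2 ^ i\<close>, terms before \<open>i\<close> give an even
  integer, the \<open>i\<close>-th term \<open>1\<close> if present, and the later ones less than
  \<open>1\<close> in total.\<close>

lemma ones_dyadic_sum:
  assumes S: "finite S" "S \<subseteq> {1..}"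
  shows "ones (\<Sum>j\<in>S. (1 / 2) ^ j) = S"
proof -
  have "odd \<lfloor>2 ^ i * (\<Sum>j\<in>S. (1 / 2 :: real) ^ j)\<rfloor> \<longleftrightarrow> i \<in> S" for i
  proof -
    define b :: int where "b = (if i \<in> S then 1 else 0)"
    define h :: int where "h = (\<Sum>j\<in>{j\<in>S. j < i}. 2 ^ (i - j - 1))"
    define t :: real where "t = 2 ^ i * (\<Sum>j\<in>{j\<in>S. i < j}. (1 / 2) ^ j)"
    have "2 ^ i * (\<Sum>j\<in>{j\<in>S. j < i}. (1 / 2 :: real) ^ j) = (\<Sum>j\<in>{j\<in>S. j < i}. 2 * 2 ^ (i - j - 1))"
      unfolding sum_distrib_left
    proof (rule sum.cong)
      fix j assume "j \<in> {j\<in>S. j < i}"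
      then have "i = Suc (i - j - 1) + j" by simp
      then have "(2 :: real) ^ i = 2 * 2 ^ (i - j - 1) * 2 ^ j"
        by (metis power_Suc power_add)
      then show "2 ^ i * (1 / 2 :: real) ^ j = 2 * 2 ^ (i - j - 1)"
        by (simp add: power_divide)
    qed simp
    then have head: "2 ^ i * (\<Sum>j\<in>{j\<in>S. j < i}. (1 / 2 :: real) ^ j) = real_of_int (2 * h)"
      by (simp add: h_def sum_distrib_left)
    have mid: "2 ^ i * (\<Sum>j\<in>S \<inter> {i}. (1 / 2 :: real) ^ j) = real_of_int b"
      by (simp add: b_def flip: power_mult_distrib)
    have split: "S = ({j\<in>S. j < i} \<union> S \<inter> {i}) \<union> {j\<in>S. i < j}" by auto
    have "(\<Sum>j\<in>S. (1 / 2 :: real) ^ j) = (\<Sum>j\<in>{j\<in>S. j < i}. (1 / 2) ^ j) +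
        (\<Sum>j\<in>S \<inter> {i}. (1 / 2) ^ j) + (\<Sum>j\<in>{j\<in>S. i < j}. (1 / 2) ^ j)"
      using S(1) by (subst split, subst sum.union_disjoint, simp, simp, force, subst sum.union_disjoint) auto
    then have "2 ^ i * (\<Sum>j\<in>S. (1 / 2 :: real) ^ j) = real_of_int (2 * h + b) + t"
      using head mid by (simp add: t_def distrib_left)
    moreover have "0 \<le> t" by (simp add: t_def sum_nonneg)
    moreover have "t < 2 ^ i * (1 / 2) ^ i"
      unfolding t_def using S by (intro mult_strict_left_mono sum_half_powers_less) auto
    then have "t < 1" by (simp flip: power_mult_distrib)
    ultimately have "\<lfloor>2 ^ i * (\<Sum>j\<in>S. (1 / 2 :: real) ^ j)\<rfloor> = 2 * h + b"
      by (intro floor_unique) linarith+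
    then show ?thesis by (simp add: b_def)
  qed
  then show ?thesis
    using S(2) unfolding ones_def by auto
qed

text \<open>Each subset of \<open>C\<close> inherits freeness from progressions and is the digit set
  of a dyadic point; distinct subsets give distinct cells.\<close>

lemma card_cells_AP_free:
  assumes C: "C \<subseteq> {1..n}" "\<not> has_AP l C"
  shows "2 ^ card C \<le> card (cells n (AP_free l))"
proof -
  have fin: "finite (cells n (AP_free l))"
    by (rule finite_cells) (auto simp: AP_free_def)
  \<comment> \<open>This decodes a cell index into its digit set, so that the subsets of
    \<open>C\<close> become images of cells.\<close>
  define digits where "digits c = {i\<in>{1..n}. odd (c div 2 ^ (n - i))}" for c :: int
  have digits: "digits \<lfloor>2 ^ n * x\<rfloor> = ones x \<inter> {..n}" for x
    unfolding digits_def ones_def by (auto simp flip: floor_pow2_coarsen)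
  have "Pow C \<subseteq> digits ` cells n (AP_free l)"
  proof
    fix S assume "S \<in> Pow C"
    then have SC: "S \<subseteq> C" "S \<subseteq> {1..n}" using C(1) by auto
    then have S: "finite S" "S \<subseteq> {1..}" "S \<subseteq> {..n}"
      by (auto dest: finite_subset)
    let ?x = "\<Sum>j\<in>S. (1 / 2 :: real) ^ j"
    have "ones ?x = S" using S by (simp add: ones_dyadic_sum)
    moreover have "\<not> has_AP l S" using C(2) SC(1) has_AP_mono by blast
    ultimately have "?x \<in> AP_free l"
      using dyadic_sum_in_circle[OF S(1,2)] by (simp add: AP_free_def)
    moreover have "digits \<lfloor>2 ^ n * ?x\<rfloor> = S"
      unfolding digits \<open>ones ?x = S\<close> using S(3) by blast
    ultimately show "S \<in> digits ` cells n (AP_free l)"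
      unfolding cells_def by (metis imageI)
  qed
  then have "card (Pow C) \<le> card (digits ` cells n (AP_free l))"
    using fin by (intro card_mono) auto
  also have "\<dots> \<le> card (cells n (AP_free l))"
    using fin by (rule card_image_le)
  also have "card (Pow C) = 2 ^ card C"
    using finite_subset[OF C(1)] by (simp add: card_Pow)
  finally show ?thesis .
qed

section \<open>Full Hausdorff dimension and the conclusion\<close>

lemma hausdorff_dim_eq_1I:
  assumes G: "G \<subseteq> circle" "G \<noteq> {}"
    and pos: "\<And>s. 0 < s \<Longrightarrow> s < 1 \<Longrightarrow> hausdorff_measure s G \<noteq> 0"
  shows "hausdorff_dim G = 1"
proof (rule antisym)
  show "1 \<le> hausdorff_dim G"
    unfolding hausdorff_dim_def
  proof (rule Inf_greatest)
    fix t assume "t \<in> {ennreal s |s. s \<ge> 0 \<and> hausdorff_measure s G = 0}"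
    then obtain s where s: "t = ennreal s" "s \<ge> 0" "hausdorff_measure s G = 0" by blast
    then have "s \<noteq> 0" using hausdorff_measure_0_eq_0 G(2) by blast
    with s pos have "s \<ge> 1" by (meson less_eq_real_def not_le)
    then show "1 \<le> t" unfolding s(1) by simp
  qed
  have "hausdorff_dim G \<le> ennreal s" if "s > 1" for s
  proof -
    have "hausdorff_measure s G = 0"
      using hausdorff_measure_mono[OF G(1), of s] hausdorff_measure_circle_eq_0[OF that] by simp
    with that show ?thesis
      unfolding hausdorff_dim_def by (intro Inf_lower) auto
  qed
  then have "hausdorff_dim G \<le> 1 + ennreal e" if "e > 0" for e
    using that by (metis ennreal_1 ennreal_plus less_add_same_cancel1 less_imp_le zero_le_one)
  then show "hausdorff_dim G \<le> 1"
    by (rule ennreal_le_epsilon)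
qed

text \<open>A thickening of density above \<open>s\<close> provides at least
  \<open>2 powr ((s + \<epsilon>) * k)\<close> words of length \<open>k\<close>, too many for the
  bound \<open>C * 2 powr (s * k)\<close> that measure zero would impose.\<close>

lemma hausdorff_measure_AP_free_pos:
  assumes A: "window_dense c A" "c > 0" "\<not> has_AP l A" and s: "0 < s" "s < 1"
  obtains N where "N \<ge> 1" "hausdorff_measure s (AP_free N) \<noteq> 0"
proof -
  define \<epsilon> where "\<epsilon> = (1 - s) / 2"
  have \<epsilon>: "\<epsilon> > 0" "1 - \<epsilon> = s + \<epsilon>" using s by (simp_all add: \<epsilon>_def field_simps)
  obtain L where L: "window_dense (1 - \<epsilon>) (thicken L A)"
    using dense_thicken[OF A(1,2) \<epsilon>(1)] .
  obtain N0 where "\<not> has_AP N0 (thicken L A)"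
    using thicken_AP_free[OF A(3)] ..
  then have N: "\<not> has_AP (max 1 N0) (thicken L A)"
    using has_AP_antimono[of "max 1 N0" _ N0] by auto
  let ?F = "AP_free (max 1 N0)"
  have "hausdorff_measure s ?F \<noteq> 0"
  proof
    assume null: "hausdorff_measure s ?F = 0"
    obtain C where C: "\<And>n. real (card (cells n ?F)) \<le> C * (2 ^ n) powr s"
      using closed_invariant_null_cells_growth[OF circle_closed_AP_free times2_invariant_AP_free s(1) _ null] s(2)
      by auto
    have "2 powr \<epsilon> > 1" using \<epsilon>(1) by simp
    then obtain K where K: "C < (2 powr \<epsilon>) ^ K"
      using real_arch_pow by blast
    obtain k M where k: "k \<ge> K" "(1 - \<epsilon>) * real k \<le> real (card (thicken L A \<inter> {M<..M + k}))"
      using L unfolding window_dense_def by blast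
    \<comment> \<open>The window is moved to \<open>{1..k}\<close>, so that its points become digit
      positions.\<close>
    define D where "D = {j\<in>{1..k}. j + M \<in> thicken L A}"
    have "thicken L A \<inter> {M<..M + k} = (\<lambda>j. j + M) ` D"
    proof (intro equalityI subsetI)
      fix x assume x: "x \<in> thicken L A \<inter> {M<..M + k}"
      then have "x = (x - M) + M" "x - M \<in> D" by (auto simp: D_def)
      then show "x \<in> (\<lambda>j. j + M) ` D" by blast
    qed (auto simp: D_def)
    then have "card (thicken L A \<inter> {M<..M + k}) = card D"
      by (simp add: card_image)
    then have D: "(s + \<epsilon>) * real k \<le> real (card D)"
      using k(2) \<epsilon>(2) by simp
    have "D \<subseteq> {j. j + M \<in> thicken L A}" by (auto simp: D_def)
    then have "\<not> has_AP (max 1 N0) D"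
      using N has_AP_mono has_AP_vimage_add by blast
    then have "2 ^ card D \<le> card (cells k ?F)"
      by (intro card_cells_AP_free) (auto simp: D_def)
    then have "(2 :: real) ^ card D \<le> real (card (cells k ?F))"
      by (metis of_nat_le_iff of_nat_numeral of_nat_power)
    also have "\<dots> \<le> C * (2 ^ k) powr s" by (rule C)
    finally have upper: "(2 :: real) powr real (card D) \<le> C * 2 powr (s * real k)"
      by (simp add: powr_realpow powr_powr mult.commute flip: powr_realpow)
    have "2 powr (\<epsilon> * real k) * 2 powr (s * real k) = 2 powr ((s + \<epsilon>) * real k)"
      by (simp add: algebra_simps flip: powr_add)
    also have "\<dots> \<le> 2 powr real (card D)" using D by simp
    also note upper
    finally have "2 powr (\<epsilon> * real k) \<le> C"
      by (simp add: mult_le_cancel_right)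
    moreover have "(2 powr \<epsilon>) ^ K \<le> (2 powr \<epsilon>) ^ k"
      using \<open>2 powr \<epsilon> > 1\<close> k(1) by (intro power_increasing) auto
    moreover have "(2 powr \<epsilon>) ^ k = 2 powr (\<epsilon> * real k)"
      by (simp add: powr_powr flip: powr_realpow)
    ultimately show False using K by simp
  qed
  then show thesis using that[of "max 1 N0"] by simp
qed

theorem theorem4p7:
  assumes "\<And>G :: real set. erdos_semigroup G \<Longrightarrow> hausdorff_dim G = 1 \<Longrightarrow> G = circle"
  shows "\<forall>A :: nat set. A \<subseteq> {1..} \<longrightarrow> upper_Banach_density A > 0 \<longrightarrow> has_arbitrarily_long_APs A"
proof (intro allI impI, rule ccontr)
  fix A :: "nat set"
  assume "upper_Banach_density A > 0" "\<not> has_arbitrarily_long_APs A"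
  then obtain c l where A: "window_dense c A" "c > 0" "\<not> has_AP l A"
    using dense_if_upper_Banach_density_pos
    unfolding has_arbitrarily_long_APs_def has_AP_def by metis
  define G where "G = (\<Union>l\<in>{1..}. AP_free l)"
  have "hausdorff_measure s G \<noteq> 0" if s: "0 < s" "s < 1" for s
  proof -
    \<comment> \<open>The index \<open>N\<close> may depend on \<open>s\<close>; the union
      \<open>G\<close> serves all \<open>s < 1\<close> at once.\<close>
    obtain N where N: "N \<ge> 1" "hausdorff_measure s (AP_free N) \<noteq> 0"
      using hausdorff_measure_AP_free_pos[OF A s] .
    then have "hausdorff_measure s (AP_free N) \<le> hausdorff_measure s G"
      unfolding G_def by (intro hausdorff_measure_mono) auto
    with N(2) show ?thesis by auto
  qed
  moreover have "0 \<in> AP_free 1"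
    by (auto simp: AP_free_def circle_def has_AP_def ones_def)
  then have "G \<noteq> {}" unfolding G_def by blast
  moreover have "G \<subseteq> circle" unfolding G_def AP_free_def by blast
  ultimately have "hausdorff_dim G = 1" by (intro hausdorff_dim_eq_1I)
  then have "G = circle"
    using assms erdos_semigroup_AP_free unfolding G_def by blast
  moreover have "2 / 3 \<in> circle" by (simp add: circle_def)
  ultimately show False
    using two_thirds_not_AP_free unfolding G_def by blast
qed

end
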